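(* Fix $m\ge2$ and a face $F$ of the Kunz cone $C_m$. Let $\mathcal M=\{x_i:1\le i\le m-1\}\cup\{y^{b_{i,j}}:1\le i,j\le m-1\}$ be a set of formal symbols. There exists a sequence of matrices $N_1,N_2,\dots$, whose entries are $\Bbbk$-linear combinations of formal products of elements of $\mathcal M$ (and which depend only on $m$ and $F$), with the following property: for every numerical semigroup $S$ of multiplicity $m$ whose Apéry coordinate vector lies in the relative interior of $F$, substituting the variables $x_i\in R$, $y=x_0$, and the values $b_{i,j}$ computed from $S$ into the entries of the $N_d$ yields the differentials of a graded minimal free resolution of $R/J_S$ (with $N_1$ presenting generators of $J_S$). In particular, the ranks of the free modules and the positions of the nonzero entries of the differentials in this minimal resolution depend only on $m$ and $F$.
   Context: A numerical semigroup is a submonoid $S\subseteq(\mathbb Z_{\ge0},+)$ containing $0$ with finite complement; its multiplicity is $m=\min(S\setminus\{0\})$. Its Apéry set is $\{n\in S:n-m\notin S\}=\{0,a_1,\dots,a_{m-1}\}$ with $a_i\equiv i\pmod m$, $a_0:=m$, and its Apéry coordinate vector is $(a_1,\dots,a_{m-1})$. Subscripts are mod $m$ in $\{0,\dots,m-1\}$. For $1\le i,j\le m-1$: $c_{i,j}=\frac1m(a_i+a_j-a_{i+j})$, $b_{i,j}=c_{i,j}$ if $i+j\not\equiv0$, $b_{i,j}=c_{i,j}+1$ if $i+j\equiv0\pmod m$. The Kunz cone $C_m\subseteq\mathbb R_{\ge0}^{m-1}$ is defined by $z_i+z_j\ge z_{i+j}$ for $1\le i\le j\le m-1$, $i+j\ne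 m$. $R=\Bbbk[x_0,\dots,x_{m-1}]$ over a field $\Bbbk$, graded by $\deg x_i=a_i$, $y=x_0$. The Apéry toric ideal is $J_S=\ker(R\to\Bbbk[t],\ x_i\mapsto t^{a_i})$. *)

theory Defs
  imports "HOL-Analysis.Analysis" "HOL-Library.Poly_Mapping"
begin

definition numerical_semigroup :: "nat set \<Rightarrow> bool" where
  "numerical_semigroup S \<longleftrightarrow> 0 \<in> S \<and> (\<forall>a\<in>S. \<forall>b\<in>S. a + b \<in> S) \<and> finite (UNIV - S)"

definition multiplicity :: "nat set \<Rightarrow> nat" where
  "multiplicity S = (LEAST n. n \<in> S \<and> n \<noteq> 0)"

definition apery :: "nat set \<Rightarrow> nat \<Rightarrow> nat" where
  "apery S i = (let m = multiplicity S in
      if i mod m = 0 then m else (LEAST n. n \<in> S \<and> n mod m = i mod m))"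

definition c_coef :: "nat set \<Rightarrow> nat \<Rightarrow> nat \<Rightarrow> nat" where
  "c_coef S i j = (let m = multiplicity S in
      (apery S i + apery S j - apery S ((i + j) mod m)) div m)"

definition b_coef :: "nat set \<Rightarrow> nat \<Rightarrow> nat \<Rightarrow> nat" where
  "b_coef S i j = (let m = multiplicity S in
      c_coef S i j + (if (i + j) mod m = 0 then 1 else 0))"

text \<open>The coordinates 1..m-1 of R^(m-1) are identified with the finite index type 'n
  through a bijection e :: nat => 'n from {1..<m} onto UNIV.\<close>

definition kunz_cone :: "nat \<Rightarrow> (nat \<Rightarrow> 'n::finite) \<Rightarrow> (real^'n) set" where
  "kunz_cone m e = {z. (\<forall>i\<in>{1..<m}. 0 \<le> z $ e i) \<and>
      (\<forall>i j. 1 \<le> i \<longrightarrow> i \<le> j \<longrightarrow> j < m \<longrightarrow> i + j \<noteq> m \<longrightarrow>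
             z $ e ((i + j) mod m) \<le> z $ e i + z $ e j)}"

definition apery_vec :: "nat \<Rightarrow> (nat \<Rightarrow> 'n::finite) \<Rightarrow> nat set \<Rightarrow> real^'n" where
  "apery_vec m e S = (\<chi> k. real (apery S (the_inv_into {1..<m} e k)))"

type_synonym ('v, 'k) mpoly = "('v \<Rightarrow>\<^sub>0 nat) \<Rightarrow>\<^sub>0 'k"

definition Var :: "'v \<Rightarrow> ('v, 'k::comm_ring_1) mpoly" where
  "Var v = Poly_Mapping.single (Poly_Mapping.single v 1) 1"

definition subst :: "('v \<Rightarrow> 'b::comm_ring_1) \<Rightarrow> ('k::comm_ring_1 \<Rightarrow> 'b) \<Rightarrow> ('v, 'k) mpoly \<Rightarrow> 'b" where
  "subst sg io f = (\<Sum>mu\<in>Poly_Mapping.keys f. io (Poly_Mapping.lookup f mu) * (\<Prod>w\<in>Poly_Mapping.keys (mu :: 'v \<Rightarrow>\<^sub>0 nat). sg w ^ Poly_Mapping.lookup mu w))"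

definition inR :: "nat \<Rightarrow> (nat, 'k::zero) mpoly \<Rightarrow> bool" where
  "inR m f \<longleftrightarrow> (\<forall>mu\<in>Poly_Mapping.keys f. \<forall>v\<in>Poly_Mapping.keys mu. v < m)"

definition wdeg :: "nat set \<Rightarrow> (nat \<Rightarrow>\<^sub>0 nat) \<Rightarrow> nat" where
  "wdeg S mu = (\<Sum>v\<in>Poly_Mapping.keys mu. Poly_Mapping.lookup mu v * apery S v)"

definition homogeneous :: "nat set \<Rightarrow> int \<Rightarrow> (nat, 'k::zero) mpoly \<Rightarrow> bool" where
  "homogeneous S d f \<longleftrightarrow> (\<forall>mu\<in>Poly_Mapping.keys f. int (wdeg S mu) = d)"

text \<open>The Apery toric ideal J_S = ker (R -> k[t], x_i |-> t^{a_i}).\<close>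
definition apery_ideal :: "nat set \<Rightarrow> (nat, 'k::field) mpoly set" where
  "apery_ideal S = {f. inR (multiplicity S) f \<and>
       (\<forall>n. (\<Sum>mu\<in>{mu\<in>Poly_Mapping.keys f. wdeg S mu = n}. Poly_Mapping.lookup f mu) = 0)}"

definition freemod :: "nat \<Rightarrow> nat \<Rightarrow> (nat \<Rightarrow> (nat, 'k::zero) mpoly) set" where
  "freemod m r = {v. (\<forall>k<r. inR m (v k)) \<and> (\<forall>k\<ge>r. v k = 0)}"

definition matmap :: "nat \<Rightarrow> nat \<Rightarrow> (nat \<Rightarrow> nat \<Rightarrow> 'a::comm_ring_1) \<Rightarrow> (nat \<Rightarrow> 'a) \<Rightarrow> (nat \<Rightarrow> 'a)" where
  "matmap r c M v = (\<lambda>i. if i < r then (\<Sum>k<c. M i k * v k) else 0)"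

text \<open>D d is the differential F_d -> F_{d-1}, an (r (d-1)) x (r d) matrix, F_0 = R.
  Graded minimal free resolution of R/J_S: image of D 1 is J_S, the complex is exact
  at every F_d (d >= 1), all entries are homogeneous of the degree prescribed by twists
  (F_d = sum_k R(-sh d k), sh 0 0 = 0), and no entry has a nonzero constant term.\<close>
definition graded_min_free_res ::
  "nat set \<Rightarrow> (nat \<Rightarrow> nat) \<Rightarrow> (nat \<Rightarrow> nat \<Rightarrow> nat \<Rightarrow> (nat, 'k::field) mpoly) \<Rightarrow> bool" where
  "graded_min_free_res S r D \<longleftrightarrow> (let m = multiplicity S in
     r 0 = 1 \<and>
     (\<forall>d\<ge>1. \<forall>i<r (d - 1). \<forall>k<r d. inR m (D d i k)) \<and>
     matmap 1 (r 1) (D 1) ` freemod m (r 1) = {v. \<exists>f\<in>apery_ideal S. v = (\<lambda>i. if i = 0 then f else 0)} \<and>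
     (\<forall>d\<ge>1. {u\<in>freemod m (r d). matmap (r (d - 1)) (r d) (D d) u = (\<lambda>_. 0)}
              = matmap (r d) (r (d + 1)) (D (d + 1)) ` freemod m (r (d + 1))) \<and>
     (\<exists>sh :: nat \<Rightarrow> nat \<Rightarrow> int. sh 0 0 = 0 \<and>
        (\<forall>d\<ge>1. \<forall>i<r (d - 1). \<forall>k<r d. homogeneous S (sh d k - sh (d - 1) i) (D d i k))) \<and>
     (\<forall>d\<ge>1. \<forall>i<r (d - 1). \<forall>k<r d. Poly_Mapping.lookup (D d i k) 0 = 0))"

text \<open>Formal symbols: X i stands for x_i, Y i j stands for y^{b_{i,j}}.\<close>
datatype sym = X nat | Y nat nat

definition sym_ok :: "nat \<Rightarrow> sym \<Rightarrow> bool" where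
  "sym_ok m s = (case s of X i \<Rightarrow> 1 \<le> i \<and> i < m | Y i j \<Rightarrow> 1 \<le> i \<and> i < m \<and> 1 \<le> j \<and> j < m)"

definition formal_ok :: "nat \<Rightarrow> (sym, 'k::zero) mpoly \<Rightarrow> bool" where
  "formal_ok m f \<longleftrightarrow> (\<forall>mu\<in>Poly_Mapping.keys f. \<forall>s\<in>Poly_Mapping.keys mu. sym_ok m s)"

definition sym_val :: "nat set \<Rightarrow> sym \<Rightarrow> (nat, 'k::field) mpoly" where
  "sym_val S s = (case s of X i \<Rightarrow> Var i | Y i j \<Rightarrow> Var 0 ^ b_coef S i j)"

definition specialize :: "nat set \<Rightarrow> (sym, 'k::field) mpoly \<Rightarrow> (nat, 'k) mpoly" where
  "specialize S f = subst (sym_val S) (\<lambda>c. Poly_Mapping.single 0 c) f"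

end

theory Submission
  imports Defs "HOL-Library.Function_Algebras" "HOL-Computational_Algebra.Polynomial"
begin

text \<open>
  Over $k[y]$ the ring $A = R/J_S$ is free on $1, x_1, \dots, x_{m-1}$, and the Koszul complex of the
  commuting endomorphisms $x_i \otimes 1 - 1 \otimes x_i$ of $R \otimes_{k[y]} A$ is a finite graded
  free resolution of $A$ over $R$. In the basis $e_T \otimes x_j$ its matrices have entries in
  $\pm x_i$, $\pm y^{b_{i,j}}$, $\pm 1$ at positions that do not depend on $S$. Whether
  $b_{i,j} = 0$ is constant on the relative interior of $F$, so the constant term of a formal entry
  is the same for all $S$ in question, and by homogeneity an entry with nonzero constant term is a
  constant. Hence unit entries can be cancelled on the level of formal matrices, simultaneously
  for all $S$; after finitely many cancellations the resolution is minimal.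
\<close>

subsection \<open>Multivariate polynomials and substitution\<close>

text \<open>The obstacle is uniformity. The formal symbols satisfy no relations, so the formal
  matrices need not even compose to zero: commutation of the two multiplications is a statement
  about the values \<open>b_{i,j}\<close>. Exactness is therefore only ever claimed after
  specialization, for all \<open>S\<close> at once, and what is shared between the semigroups is
  just the index sets, the formal entries and their constant terms. A formal pivot need not be a
  constant either; it may be a symbol for \<open>y^{b_{i,j}}\<close> with
  \<open>b_{i,j} = 0\<close>. Only its common value \<open>c\<close> in the field is known, and
  elimination with the scalar \<open>1 / c\<close> is what keeps the new entries formal.

  The Koszul complex begins with \<open>m\<close> generators in degree 0, one for each basis element
  of \<open>A\<close>, whereas \<open>R/J_S\<close> needs a single one. The generator
  \<open>({}, 0)\<close>, which maps to 1, is never cancelled. Any other one is removed eventually,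
  because it equals \<open>x_j\<close> times the first in \<open>A\<close> and hence occurs in a
  relation with a unit coefficient. Once only \<open>({}, 0)\<close> is left, the entries of its row
  lie in \<open>J_S\<close> and have no constant term, so leaving this row out of the cancellation
  costs nothing.\<close>

lemma poly_mapping_sum_singles:
  fixes f :: "'a \<Rightarrow>\<^sub>0 'b::comm_monoid_add"
  shows "f = (\<Sum>mu\<in>Poly_Mapping.keys f. Poly_Mapping.single mu (Poly_Mapping.lookup f mu))"
  by (rule poly_mapping_eqI) (simp add: lookup_sum lookup_single when_def in_keys_iff)

lemma poly_mapping_add_induct [case_names zero single add]:
  fixes f :: "'a \<Rightarrow>\<^sub>0 'b::comm_monoid_add"
  assumes "P 0" and "\<And>mu c. P (Poly_Mapping.single mu c)"
    and "\<And>f g. P f \<Longrightarrow> P g \<Longrightarrow> P (f + g)"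
  shows "P f"
proof -
  have "P (\<Sum>mu\<in>A. Poly_Mapping.single mu (Poly_Mapping.lookup f mu))" for A
    by (induction A rule: infinite_finite_induct) (auto intro: assms)
  then show ?thesis
    by (subst poly_mapping_sum_singles)
qed

text \<open>Common form of \<open>inR\<close> and \<open>formal_ok\<close>, and of the filtration by
  the variables allowed so far; the closure properties are thus shown once for all three.\<close>

definition vars_in :: "'v set \<Rightarrow> ('v, 'k::zero) mpoly \<Rightarrow> bool" where
  "vars_in V f \<longleftrightarrow> (\<forall>mu\<in>Poly_Mapping.keys f. Poly_Mapping.keys mu \<subseteq> V)"

lemma vars_in_mono: "vars_in V f \<Longrightarrow> V \<subseteq> W \<Longrightarrow> vars_in W f"
  by (auto simp: vars_in_def)

lemma vars_in_0 [simp]: "vars_in V 0"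
  by (simp add: vars_in_def)

lemma vars_in_const [simp]: "vars_in V (Poly_Mapping.single 0 c)"
  by (simp add: vars_in_def)

lemma vars_in_1 [simp]: "vars_in V (1 :: ('v, 'k::comm_ring_1) mpoly)"
  by (simp add: vars_in_def)

lemma vars_in_Var: "v \<in> V \<Longrightarrow> vars_in V (Var v)"
  by (simp add: vars_in_def Var_def)

lemma vars_in_add: "vars_in V f \<Longrightarrow> vars_in V g \<Longrightarrow> vars_in V (f + g)"
  using keys_add[of f g] by (auto simp: vars_in_def)

lemma vars_in_uminus:
  fixes f :: "('v, 'k::comm_ring_1) mpoly"
  shows "vars_in V f \<Longrightarrow> vars_in V (- f)"
  by (auto simp: vars_in_def in_keys_iff)

lemma vars_in_diff:
  fixes f :: "('v, 'k::comm_ring_1) mpoly"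
  shows "vars_in V f \<Longrightarrow> vars_in V g \<Longrightarrow> vars_in V (f - g)"
  using vars_in_add[of V f "- g"] vars_in_uminus[of V g] by simp

lemma vars_in_mult:
  fixes f :: "('v, 'k::comm_ring_1) mpoly"
  assumes "vars_in V f" "vars_in V g"
  shows "vars_in V (f * g)"
  unfolding vars_in_def
proof
  fix mu assume "mu \<in> Poly_Mapping.keys (f * g)"
  then obtain a b where "mu = a + b" "a \<in> Poly_Mapping.keys f" "b \<in> Poly_Mapping.keys g"
    using keys_mult[of f g] by auto
  then show "Poly_Mapping.keys mu \<subseteq> V"
    using assms keys_add[of a b] unfolding vars_in_def by blast
qed

lemma vars_in_power:
  fixes f :: "('v, 'k::comm_ring_1) mpoly"
  shows "vars_in V f \<Longrightarrow> vars_in V (f ^ n)"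
  by (induction n) (auto intro: vars_in_mult)

lemma vars_in_sum:
  fixes f :: "'a \<Rightarrow> ('v, 'k::comm_ring_1) mpoly"
  shows "(\<And>x. x \<in> A \<Longrightarrow> vars_in V (f x)) \<Longrightarrow> vars_in V (\<Sum>x\<in>A. f x)"
  by (induction A rule: infinite_finite_induct) (auto intro: vars_in_add)

lemma inR_iff_vars_in: "inR m f \<longleftrightarrow> vars_in {..<m} f"
  by (auto simp: inR_def vars_in_def)

lemma formal_ok_iff_vars_in: "formal_ok m f \<longleftrightarrow> vars_in (Collect (sym_ok m)) f"
  by (auto simp: formal_ok_def vars_in_def)

section \<open>Substitution homomorphisms\<close>

definition monom_val :: "('v \<Rightarrow> 'b::comm_ring_1) \<Rightarrow> ('v \<Rightarrow>\<^sub>0 nat) \<Rightarrow> 'b" where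
  "monom_val sg mu = (\<Prod>w\<in>Poly_Mapping.keys mu. sg w ^ Poly_Mapping.lookup mu w)"

lemma monom_val_superset:
  assumes "finite A" "Poly_Mapping.keys mu \<subseteq> A"
  shows "monom_val sg mu = (\<Prod>w\<in>A. sg w ^ Poly_Mapping.lookup mu w)"
  unfolding monom_val_def using assms
  by (intro prod.mono_neutral_left) (auto simp: in_keys_iff)

lemma monom_val_add: "monom_val sg (mu + nu) = monom_val sg mu * monom_val sg nu"
proof -
  let ?A = "Poly_Mapping.keys mu \<union> Poly_Mapping.keys nu"
  have "monom_val sg (mu + nu) = (\<Prod>w\<in>?A. sg w ^ Poly_Mapping.lookup (mu + nu) w)"
    using keys_add[of mu nu] by (intro monom_val_superset) auto
  also have "\<dots> = (\<Prod>w\<in>?A. sg w ^ Poly_Mapping.lookup mu w) * (\<Prod>w\<in>?A. sg w ^ Poly_Mapping.lookup nu w)"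
    by (simp add: lookup_add power_add prod.distrib)
  also have "\<dots> = monom_val sg mu * monom_val sg nu"
    by (subst (1 2) monom_val_superset[of ?A]) auto
  finally show ?thesis .
qed

lemma monom_val_0 [simp]: "monom_val sg 0 = 1"
  by (simp add: monom_val_def)

lemma monom_val_single [simp]: "monom_val sg (Poly_Mapping.single v n) = sg v ^ n"
  by (cases "n = 0") (auto simp: monom_val_def)

lemma subst_monom_val:
  "subst sg io f = (\<Sum>mu\<in>Poly_Mapping.keys f. io (Poly_Mapping.lookup f mu) * monom_val sg mu)"
  by (simp add: subst_def monom_val_def)

text \<open>Used for two targets: constants embedded into polynomials, which gives
  \<open>specialize\<close>, and constants embedded into \<open>k[t]\<close>, which gives the toric
  map.\<close>

locale coeff_hom =
  fixes io :: "'k::comm_ring_1 \<Rightarrow> 'b::comm_ring_1"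
  assumes io_0: "io 0 = 0" and io_1: "io 1 = 1"
    and io_add: "io (a + b) = io a + io b" and io_mult: "io (a * b) = io a * io b"
begin

lemma subst_superset:
  assumes "finite A" "Poly_Mapping.keys f \<subseteq> A"
  shows "subst sg io f = (\<Sum>mu\<in>A. io (Poly_Mapping.lookup f mu) * monom_val sg mu)"
  unfolding subst_monom_val using assms
  by (intro sum.mono_neutral_left) (auto simp: in_keys_iff io_0)

lemma subst_0 [simp]: "subst sg io 0 = 0"
  by (simp add: subst_def)

lemma subst_add: "subst sg io (f + g) = subst sg io f + subst sg io g"
proof -
  let ?A = "Poly_Mapping.keys f \<union> Poly_Mapping.keys g"
  have "subst sg io (f + g) = (\<Sum>mu\<in>?A. io (Poly_Mapping.lookup (f + g) mu) * monom_val sg mu)"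
    using keys_add[of f g] by (intro subst_superset) auto
  also have "\<dots> = subst sg io f + subst sg io g"
    by (subst (1 2) subst_superset[of ?A]) (auto simp: lookup_add io_add algebra_simps sum.distrib)
  finally show ?thesis .
qed

lemma subst_single: "subst sg io (Poly_Mapping.single mu c) = io c * monom_val sg mu"
  by (cases "c = 0") (auto simp: subst_monom_val io_0)

lemma subst_mult: "subst sg io (f * g) = subst sg io f * subst sg io g"
proof (induction f rule: poly_mapping_add_induct)
  case (single mu c)
  show ?case
  proof (induction g rule: poly_mapping_add_induct)
    case (single nu d)
    show ?case
      by (simp add: mult_single subst_single monom_val_add io_mult algebra_simps)
  qed (auto simp: subst_add algebra_simps)
qed (auto simp: subst_add algebra_simps)

lemma subst_1 [simp]: "subst sg io 1 = 1"
  using subst_single[of sg 0 1] by (simp add: io_1)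

lemma subst_uminus: "subst sg io (- f) = - subst sg io f"
  using subst_add[of sg f "- f"] by (simp add: eq_neg_iff_add_eq_0 add.commute)

lemma subst_diff: "subst sg io (f - g) = subst sg io f - subst sg io g"
  using subst_add[of sg f "- g"] by (simp add: subst_uminus)

lemma subst_sum: "subst sg io (\<Sum>x\<in>A. f x) = (\<Sum>x\<in>A. subst sg io (f x))"
  by (induction A rule: infinite_finite_induct) (auto simp: subst_add)

lemma subst_power: "subst sg io (f ^ n) = subst sg io f ^ n"
  by (induction n) (auto simp: subst_mult)

lemma subst_Var: "subst sg io (Var v) = sg v"
  by (simp add: Var_def subst_single io_1)

end

lemma Var_power: "Var v ^ n = Poly_Mapping.single (Poly_Mapping.single v n) 1"
  by (induction n) (auto simp: Var_def mult_single simp flip: single_add)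

text \<open>Reduction modulo the ideal of all variables. It is a ring homomorphism, and its
  vanishing on matrix entries is minimality.\<close>

definition cterm :: "('v, 'k::zero) mpoly \<Rightarrow> 'k" where
  "cterm f = Poly_Mapping.lookup f 0"

lemma nat_poly_mapping_add_eq_0:
  "mu + nu = (0 :: 'v \<Rightarrow>\<^sub>0 nat) \<longleftrightarrow> mu = 0 \<and> nu = 0"
  by (auto simp: poly_mapping_eq_iff fun_eq_iff lookup_add)

lemma cterm_0 [simp]: "cterm 0 = 0"
  and cterm_const [simp]: "cterm (Poly_Mapping.single 0 c) = c"
  and cterm_1 [simp]: "cterm (1 :: ('v, 'k::comm_ring_1) mpoly) = 1"
  and cterm_add: "cterm (f + g) = cterm f + (cterm g :: 'k::comm_ring_1)"
  by (auto simp: cterm_def lookup_add)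

lemma cterm_mult: "cterm (f * g) = cterm f * (cterm g :: 'k::comm_ring_1)"
proof (induction f rule: poly_mapping_add_induct)
  case (single mu c)
  show ?case
  proof (induction g rule: poly_mapping_add_induct)
    case (single nu d)
    show ?case
      by (auto simp: mult_single cterm_def lookup_single when_def nat_poly_mapping_add_eq_0)
  qed (auto simp: cterm_add algebra_simps)
qed (auto simp: cterm_add algebra_simps)

lemma cterm_sum: "cterm (\<Sum>x\<in>A. f x) = (\<Sum>x\<in>A. cterm (f x :: ('v, 'k::comm_ring_1) mpoly))"
  by (induction A rule: infinite_finite_induct) (auto simp: cterm_add)

lemma cterm_prod: "cterm (\<Prod>x\<in>A. f x) = (\<Prod>x\<in>A. cterm (f x :: ('v, 'k::comm_ring_1) mpoly))"
  by (induction A rule: infinite_finite_induct) (auto simp: cterm_mult)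

lemma cterm_power: "cterm (f ^ n) = cterm (f :: ('v, 'k::comm_ring_1) mpoly) ^ n"
  by (induction n) (auto simp: cterm_mult)

lemma cterm_Var [simp]: "cterm (Var v :: ('v, 'k::comm_ring_1) mpoly) = 0"
proof -
  have "Poly_Mapping.single v (1::nat) \<noteq> 0"
    by (metis lookup_single_eq lookup_zero zero_neq_one)
  then show ?thesis
    by (simp add: cterm_def Var_def lookup_single)
qed

interpretation const_hom: coeff_hom "Poly_Mapping.single 0 :: 'k::comm_ring_1 \<Rightarrow> ('v, 'k) mpoly"
  by unfold_locales (auto simp: single_add mult_single)

interpretation poly_const_hom: coeff_hom "\<lambda>c. [:c :: 'k::comm_ring_1:]"
  by unfold_locales auto

subsection \<open>Koszul complexes of commuting endomorphisms\<close>

text \<open>The sign \<open>(-1)^n\<close> on a bare abelian group, which has no scalar -1.\<close>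

definition alt :: "nat \<Rightarrow> 'b::ab_group_add \<Rightarrow> 'b" where
  "alt n x = (if even n then x else - x)"

lemma alt_add: "alt n (x + y) = alt n x + alt n y"
  and alt_uminus: "alt n (- x) = - alt n x"
  and alt_0 [simp]: "alt n 0 = 0"
  and alt_alt [simp]: "alt n (alt n x) = x"
  and alt_Suc: "alt (Suc n) x = - alt n x"
  and alt_swap: "alt n (alt k x) = alt k (alt n x)"
  by (auto simp: alt_def)

lemma alt_sum: "alt n (\<Sum>x\<in>A. g x) = (\<Sum>x\<in>A. alt n (g x))"
  by (simp add: alt_def sum_negf)

text \<open>The Koszul differential in all degrees at once: a chain \<open>u\<close> has component
  \<open>u T\<close> at the basis element \<open>e_T\<close>, and the sign counts the elements of
  \<open>T\<close> that precede \<open>i\<close>.\<close>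

definition koszul :: "(nat \<Rightarrow> 'b \<Rightarrow> 'b) \<Rightarrow> nat \<Rightarrow> (nat set \<Rightarrow> 'b) \<Rightarrow> nat set \<Rightarrow> 'b::ab_group_add" where
  "koszul f k u T = (\<Sum>i\<in>{1..k} - T. alt (card (T \<inter> {..<i})) (f i (u (insert i T))))"

lemma koszul_0 [simp]: "koszul f 0 u T = 0"
  by (simp add: koszul_def)

text \<open>The complex for \<open>k + 1\<close> endomorphisms is the cone of the last one acting on
  the complex for \<open>k\<close>. All inductions below go through this splitting.\<close>

lemma koszul_Suc:
  "koszul f (Suc k) u T = koszul f k u T +
     (if Suc k \<in> T then 0 else alt (card (T \<inter> {..<Suc k})) (f (Suc k) (u (insert (Suc k) T))))"
proof (cases "Suc k \<in> T")
  case True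
  then have "{1..Suc k} - T = {1..k} - T"
    by (auto simp: le_Suc_eq)
  then show ?thesis
    using True by (simp add: koszul_def)
next
  case False
  then have "{1..Suc k} - T = insert (Suc k) ({1..k} - T)"
    by (auto simp: le_Suc_eq)
  then show ?thesis
    using False by (simp add: koszul_def add.commute)
qed

lemma koszul_cong:
  "(\<And>i. i \<in> {1..k} - T \<Longrightarrow> u (insert i T) = v (insert i T)) \<Longrightarrow> koszul f k u T = koszul f k v T"
  by (simp add: koszul_def)

locale commuting_endos =
  fixes f :: "nat \<Rightarrow> 'b::ab_group_add \<Rightarrow> 'b" and n :: nat
  assumes f_add: "i \<in> {1..n} \<Longrightarrow> f i (a + b) = f i a + f i b"
    and f_commute: "i \<in> {1..n} \<Longrightarrow> j \<in> {1..n} \<Longrightarrow> f i (f j a) = f j (f i a)"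
begin

lemma f_0: "i \<in> {1..n} \<Longrightarrow> f i 0 = 0"
  using f_add[of i 0 0] by simp

lemma f_uminus: "i \<in> {1..n} \<Longrightarrow> f i (- a) = - f i a"
  using f_add[of i a "- a"] by (simp add: f_0 eq_neg_iff_add_eq_0 add.commute)

lemma f_alt: "i \<in> {1..n} \<Longrightarrow> f i (alt c a) = alt c (f i a)"
  by (simp add: alt_def f_uminus)

lemma f_sum: "i \<in> {1..n} \<Longrightarrow> f i (\<Sum>x\<in>A. g x) = (\<Sum>x\<in>A. f i (g x))"
  by (induction A rule: infinite_finite_induct) (auto simp: f_add f_0)

lemma koszul_add:
  assumes "k \<le> n"
  shows "koszul f k (\<lambda>T. u T + v T) T = koszul f k u T + koszul f k v T"
  using assms by (simp add: koszul_def f_add alt_add sum.distrib)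

lemma koszul_uminus:
  assumes "k \<le> n"
  shows "koszul f k (\<lambda>T. - u T) T = - koszul f k u T"
  using assms by (simp add: koszul_def f_uminus alt_uminus sum_negf)

text \<open>In the cone only the mixed terms are new: \<open>f (Suc k)\<close> before and after the
  lower differential. They agree because the endomorphisms commute, and they have opposite signs
  because inserting some \<open>i \<le> k\<close> moves \<open>Suc k\<close> up by one
  position.\<close>

lemma koszul_koszul:
  assumes "k \<le> n"
  shows "koszul f k (koszul f k u) T = 0"
  using assms
proof (induction k arbitrary: u T)
  case 0
  then show ?case by simp
next
  case (Suc k)
  then have kn: "k \<le> n" "Suc k \<in> {1..n}" by auto
  show ?case
  proof (cases "Suc k \<in> T")
    case True
    have "koszul f (Suc k) (koszul f (Suc k) u) T = koszul f k (koszul f (Suc k) u) T"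
      using True by (simp add: koszul_Suc)
    also have "\<dots> = koszul f k (koszul f k u) T"
      using True by (intro koszul_cong) (simp add: koszul_Suc)
    finally show ?thesis
      using Suc.IH[OF kn(1)] by simp
  next
    case False
    define c where "c = card (T \<inter> {..<Suc k})"
    define g where "g = (\<lambda>i. alt (card (T \<inter> {..<i})) (f i (alt c (f (Suc k) (u (insert (Suc k) (insert i T)))))))"
    have card_insert: "card (insert i T \<inter> {..<Suc k}) = Suc c" if "i \<in> {1..k} - T" for i
    proof -
      have "insert i T \<inter> {..<Suc k} = insert i (T \<inter> {..<Suc k})"
        using that by auto
      then show ?thesis
        using that by (simp add: c_def)
    qed
    have card_insert': "card (insert (Suc k) T \<inter> {..<i}) = card (T \<inter> {..<i})" if "i \<in> {1..k}" for i
    proof -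
      have "insert (Suc k) T \<inter> {..<i} = T \<inter> {..<i}"
        using that by auto
      then show ?thesis by simp
    qed
    have diff_eq: "{1..k} - insert (Suc k) T = {1..k} - T"
      by auto
    have "koszul f k (koszul f (Suc k) u) T
        = koszul f k (\<lambda>T'. koszul f k u T' + - alt c (f (Suc k) (u (insert (Suc k) T')))) T"
      using False by (intro koszul_cong) (auto simp: koszul_Suc card_insert alt_Suc simp flip: c_def)
    also have "\<dots> = - koszul f k (\<lambda>T'. alt c (f (Suc k) (u (insert (Suc k) T')))) T"
      using kn by (simp only: koszul_add koszul_uminus Suc.IH) simp
    also have "koszul f k (\<lambda>T'. alt c (f (Suc k) (u (insert (Suc k) T')))) T = (\<Sum>i\<in>{1..k} - T. g i)"
      by (simp add: koszul_def g_def)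
    finally have 1: "koszul f k (koszul f (Suc k) u) T = - (\<Sum>i\<in>{1..k} - T. g i)" .
    have "koszul f (Suc k) u (insert (Suc k) T) = koszul f k u (insert (Suc k) T)"
      by (simp add: koszul_Suc)
    then have "alt c (f (Suc k) (koszul f (Suc k) u (insert (Suc k) T)))
        = alt c (f (Suc k) (\<Sum>i\<in>{1..k} - T. alt (card (T \<inter> {..<i})) (f i (u (insert i (insert (Suc k) T))))))"
      by (simp add: koszul_def diff_eq card_insert')
    also have "\<dots> = (\<Sum>i\<in>{1..k} - T. g i)"
      unfolding f_sum[OF kn(2)] alt_sum g_def
    proof (intro sum.cong refl)
      fix i assume "i \<in> {1..k} - T"
      then have i: "i \<in> {1..n}" using kn by auto
      then show "alt c (f (Suc k) (alt (card (T \<inter> {..<i})) (f i (u (insert i (insert (Suc k) T))))))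
        = alt (card (T \<inter> {..<i})) (f i (alt c (f (Suc k) (u (insert (Suc k) (insert i T))))))"
        by (simp only: f_alt[OF i] f_alt[OF kn(2)] f_commute[OF i kn(2)] alt_swap[of c] insert_commute)
    qed
    finally have 2: "alt c (f (Suc k) (koszul f (Suc k) u (insert (Suc k) T))) = (\<Sum>i\<in>{1..k} - T. g i)" .
    have "koszul f (Suc k) (koszul f (Suc k) u) T = koszul f k (koszul f (Suc k) u) T
       + alt c (f (Suc k) (koszul f (Suc k) u (insert (Suc k) T)))"
      using False by (simp add: koszul_Suc[of f k "koszul f (Suc k) u"] c_def)
    with 1 2 show ?thesis by simp
  qed
qed

end

text \<open>Each $f_k$ acts on $M_k$ like multiplication by a new variable over $M_{k-1}$, up to lower
  terms: every element of $M_k$ has a unique remainder in $M_{k-1}$ modulo $f_k$.\<close>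

locale koszul_filtration = commuting_endos f n
  for f :: "nat \<Rightarrow> 'b::ab_group_add \<Rightarrow> 'b" and n :: nat +
  fixes M :: "nat \<Rightarrow> 'b set" and aug :: "'b \<Rightarrow> 'c::ab_group_add"
  assumes M_0: "0 \<in> M k"
    and M_add: "a \<in> M k \<Longrightarrow> b \<in> M k \<Longrightarrow> a + b \<in> M k"
    and M_uminus: "a \<in> M k \<Longrightarrow> - a \<in> M k"
    and M_mono: "a \<in> M k \<Longrightarrow> a \<in> M (Suc k)"
    and M_f: "i \<in> {1..k} \<Longrightarrow> k \<le> n \<Longrightarrow> a \<in> M k \<Longrightarrow> f i a \<in> M k"
    and division: "Suc k \<le> n \<Longrightarrow> a \<in> M (Suc k) \<Longrightarrow> \<exists>q\<in>M (Suc k). \<exists>r\<in>M k. a = f (Suc k) q + r"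
    and cancel: "Suc k \<le> n \<Longrightarrow> a \<in> M (Suc k) \<Longrightarrow> f (Suc k) a \<in> M k \<Longrightarrow> a = 0"
    and aug_add: "aug (a + b) = aug a + aug b"
    and aug_f: "i \<in> {1..n} \<Longrightarrow> aug (f i a) = 0"
    and aug_inj: "a \<in> M 0 \<Longrightarrow> aug a = 0 \<Longrightarrow> a = 0"
begin

lemma M_alt: "a \<in> M k \<Longrightarrow> alt c a \<in> M k"
  by (simp add: alt_def M_uminus)

lemma M_sum: "(\<And>x. x \<in> A \<Longrightarrow> g x \<in> M k) \<Longrightarrow> (\<Sum>x\<in>A. g x) \<in> M k"
  by (induction A rule: infinite_finite_induct) (auto intro: M_0 M_add)

lemma M_koszul:
  assumes "k \<le> n" "T \<subseteq> {1..k}" "\<And>T. T \<subseteq> {1..k} \<Longrightarrow> u T \<in> M k"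
  shows "koszul f k u T \<in> M k"
  unfolding koszul_def using assms
  by (intro M_sum M_alt M_f) auto

lemma aug_0: "aug 0 = 0"
  using aug_add[of 0 0] by simp

lemma aug_uminus: "aug (- a) = - aug a"
  using aug_add[of a "- a"] by (simp add: aug_0 eq_neg_iff_add_eq_0 add.commute)

lemma aug_sum: "aug (\<Sum>x\<in>A. g x) = (\<Sum>x\<in>A. aug (g x))"
  by (induction A rule: infinite_finite_induct) (auto simp: aug_add aug_0)

lemma aug_koszul: "k \<le> n \<Longrightarrow> aug (koszul f k u T) = 0"
  unfolding koszul_def aug_sum by (intro sum.neutral) (auto simp: alt_def aug_uminus aug_f)

text \<open>A cycle is changed by a boundary until its components without \<open>Suc k\<close> lie
  in \<open>M k\<close>. Then \<open>cancel\<close> kills the components containing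
  \<open>Suc k\<close>, and the rest is a cycle for \<open>k\<close> endomorphisms. The component at
  \<open>{}\<close> never enters the differential, so degree 0 needs its own condition on
  \<open>aug\<close>; in the base case it is the only condition.\<close>

theorem koszul_exact:
  assumes "k \<le> n"
    and "\<And>T. T \<subseteq> {1..k} \<Longrightarrow> u T \<in> M k"
    and "\<And>T. T \<subseteq> {1..k} \<Longrightarrow> koszul f k u T = 0"
    and "aug (u {}) = 0"
  shows "\<exists>w. (\<forall>T. w T \<in> M k) \<and> (\<forall>T. T \<subseteq> {1..k} \<longrightarrow> u T = koszul f k w T)"
  using assms
proof (induction k arbitrary: u)
  case 0
  then have "u {} = 0" by (auto intro: aug_inj)
  then show ?case by (intro exI[of _ "\<lambda>_. 0"]) (auto simp: M_0)
next
  case (Suc k)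
  then have kn: "k \<le> n" "Suc k \<le> n" "Suc k \<in> {1..n}" by auto
  have notin: "Suc k \<notin> T" if "T \<subseteq> {1..k}" for T
    using that by auto
  have mono: "T \<subseteq> {1..Suc k}" "insert (Suc k) T \<subseteq> {1..Suc k}" if "T \<subseteq> {1..k}" for T
    using that by auto
  have "\<exists>q r. q \<in> M (Suc k) \<and> r \<in> M k \<and> u T = f (Suc k) q + r" if "T \<subseteq> {1..k}" for T
    using division[OF kn(2) Suc.prems(2)[OF mono(1)[OF that]]] by blast
  then obtain q r where qr: "\<And>T. T \<subseteq> {1..k} \<Longrightarrow> q T \<in> M (Suc k)" "\<And>T. T \<subseteq> {1..k} \<Longrightarrow> r T \<in> M k"
      "\<And>T. T \<subseteq> {1..k} \<Longrightarrow> u T = f (Suc k) (q T) + r T"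
    by metis
  define c where "c T = card (T \<inter> {..<Suc k})" for T :: "nat set"
  \<comment> \<open>Chosen so that its boundary at \<open>T\<close> is
    \<open>f (Suc k) (q T)\<close>: the sign \<open>alt (c T)\<close> undoes the Koszul sign, and
    \<open>c\<close> does not change when \<open>Suc k\<close> is inserted.\<close>
  define w1 where "w1 T = (if T \<subseteq> {1..Suc k} \<and> Suc k \<in> T then alt (c T) (q (T - {Suc k})) else 0)" for T
  have c_insert: "c (insert (Suc k) T) = c T" for T
  proof -
    have "insert (Suc k) T \<inter> {..<Suc k} = T \<inter> {..<Suc k}" by auto
    then show ?thesis by (simp add: c_def)
  qed
  have w1M: "w1 T \<in> M (Suc k)" for T
  proof (cases "T \<subseteq> {1..Suc k} \<and> Suc k \<in> T")
    case True
    then have "T - {Suc k} \<subseteq> {1..k}" by (auto simp: le_Suc_eq)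
    then show ?thesis using True qr by (auto simp: w1_def intro!: M_alt)
  qed (auto simp: w1_def M_0)
  \<comment> \<open>Homologous to \<open>u\<close>; on subsets of \<open>{1..k}\<close> only the
    remainders \<open>r T\<close> are left.\<close>
  define v where "v T = u T - koszul f (Suc k) w1 T" for T
  have kw1: "koszul f (Suc k) w1 T = f (Suc k) (q T)" if T: "T \<subseteq> {1..k}" for T
  proof -
    have "koszul f k w1 T = 0"
      unfolding koszul_def
    proof (intro sum.neutral ballI)
      fix i assume "i \<in> {1..k} - T"
      then have "w1 (insert i T) = 0" "i \<in> {1..n}"
        using T notin[OF T] kn by (auto simp: w1_def)
      then show "alt (card (T \<inter> {..<i})) (f i (w1 (insert i T))) = 0"
        by (simp add: f_0)
    qed
    moreover have "w1 (insert (Suc k) T) = alt (c T) (q T)"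
      using T notin[OF T] mono[OF T] by (simp add: w1_def c_insert)
    ultimately show ?thesis
      using notin[OF T] by (simp add: koszul_Suc f_alt[OF kn(3)] flip: c_def)
  qed
  have v_lower: "v T \<in> M k" if "T \<subseteq> {1..k}" for T
    using that qr by (simp add: v_def kw1)
  have v_M: "v T \<in> M (Suc k)" if "T \<subseteq> {1..Suc k}" for T
    using M_add[OF Suc.prems(2)[OF that] M_uminus[OF M_koszul[OF kn(2) that w1M]]] by (simp add: v_def)
  have v_cycle: "koszul f (Suc k) v T = 0" if "T \<subseteq> {1..Suc k}" for T
  proof -
    have "koszul f (Suc k) v T = koszul f (Suc k) (\<lambda>T. u T + - koszul f (Suc k) w1 T) T"
      by (simp add: v_def[abs_def])
    also have "\<dots> = 0"
      unfolding koszul_add[OF kn(2)] koszul_uminus[OF kn(2)]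
      using Suc.prems(3)[OF that] by (simp add: koszul_koszul[OF kn(2)])
    finally show ?thesis .
  qed
  have v_aug: "aug (v {}) = 0"
    using aug_add[of "u {}" "- koszul f (Suc k) w1 {}"] Suc.prems(4)
    by (simp add: v_def aug_uminus aug_koszul[OF kn(2)])
  \<comment> \<open>The cycle condition at \<open>T\<close> writes \<open>f (Suc k)\<close> of this
    component, up to sign, as a lower differential, hence as an element of
    \<open>M k\<close>.\<close>
  have v_top: "v (insert (Suc k) T) = 0" if T: "T \<subseteq> {1..k}" for T
  proof -
    have "koszul f k v T + alt (c T) (f (Suc k) (v (insert (Suc k) T))) = 0"
      using v_cycle[OF mono(1)[OF T]] notin[OF T] by (simp add: koszul_Suc c_def)
    then have "alt (c T) (f (Suc k) (v (insert (Suc k) T))) = - koszul f k v T"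
      by (simp add: eq_neg_iff_add_eq_0 add.commute)
    then have "f (Suc k) (v (insert (Suc k) T)) = alt (c T) (- koszul f k v T)"
      by (metis alt_alt)
    also have "\<dots> \<in> M k"
      using T kn v_lower by (intro M_alt M_uminus M_koszul) auto
    finally show ?thesis
      using cancel[OF kn(2) v_M[OF mono(2)[OF T]]] by simp
  qed
  have "koszul f k v T = 0" if T: "T \<subseteq> {1..k}" for T
    using v_cycle[OF mono(1)[OF T]] notin[OF T] by (simp add: koszul_Suc v_top[OF T] f_0[OF kn(3)])
  from Suc.IH[OF kn(1) v_lower this v_aug] obtain w'
    where w': "\<And>T. w' T \<in> M k" "\<And>T. T \<subseteq> {1..k} \<Longrightarrow> v T = koszul f k w' T"
    by blast
  \<comment> \<open>Zero on sets containing \<open>Suc k\<close>, so that the passage from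
    \<open>k\<close> to \<open>k + 1\<close> endomorphisms adds no term to the boundary.\<close>
  define w2 where "w2 T = (if Suc k \<in> T then 0 else w' T)" for T
  have w2M: "w2 T \<in> M (Suc k)" for T
    using w' by (simp add: w2_def M_0 M_mono)
  have v_eq: "v T = koszul f (Suc k) w2 T" if T: "T \<subseteq> {1..Suc k}" for T
  proof (cases "Suc k \<in> T")
    case True
    then obtain T' where T': "T = insert (Suc k) T'" "Suc k \<notin> T'"
      by (meson mk_disjoint_insert)
    then have "T' \<subseteq> {1..k}" using T by (auto simp: le_Suc_eq)
    then have "v T = 0" using v_top T' by simp
    moreover have "koszul f (Suc k) w2 T = 0"
      unfolding koszul_def using True kn f_0
      by (intro sum.neutral) (auto simp: w2_def)
    ultimately show ?thesis by simp
  next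
    case False
    then have T': "T \<subseteq> {1..k}" using T by (auto simp: le_Suc_eq subset_eq)
    have "koszul f (Suc k) w2 T = koszul f k w2 T"
      using False by (simp add: koszul_Suc w2_def f_0[OF kn(3)])
    also have "\<dots> = koszul f k w' T"
      using False by (intro koszul_cong) (auto simp: w2_def)
    finally show ?thesis using w'(2)[OF T'] by simp
  qed
  have "u T = koszul f (Suc k) (\<lambda>T. w1 T + w2 T) T" if T: "T \<subseteq> {1..Suc k}" for T
    unfolding koszul_add[OF kn(2)] using v_eq[OF T] by (simp add: v_def algebra_simps)
  then show ?case
    using w1M w2M by (intro exI[of _ "\<lambda>T. w1 T + w2 T"]) (auto intro: M_add)
qed

end

subsection \<open>Cancelling unit entries of a complex\<close>

definition in_ker :: "'a set \<Rightarrow> ('a \<Rightarrow> 'b \<Rightarrow> 'r::comm_ring_1) \<Rightarrow> 'b set \<Rightarrow> ('b \<Rightarrow> 'r) \<Rightarrow> bool" where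
  "in_ker I C J u \<longleftrightarrow> (\<forall>i\<in>I. (\<Sum>j\<in>J. C i j * u j) = 0)"

text \<open>The cycle condition \<open>K\<close> is an arbitrary predicate because the augmentation
  is not a matrix over the same ring. Coordinates are restricted to a subring \<open>U\<close>
  because the polynomial type has more variables than \<open>R\<close>.\<close>

definition exact_at ::
  "'r::comm_ring_1 set \<Rightarrow> (('a \<Rightarrow> 'r) \<Rightarrow> bool) \<Rightarrow> 'a set \<Rightarrow> ('a \<Rightarrow> 'b \<Rightarrow> 'r) \<Rightarrow> 'b set \<Rightarrow> bool" where
  "exact_at U K J D L \<longleftrightarrow> (\<forall>u. (\<forall>j\<in>J. u j \<in> U) \<longrightarrow>
     (K u \<longleftrightarrow> (\<exists>w. (\<forall>l\<in>L. w l \<in> U) \<and> (\<forall>j\<in>J. u j = (\<Sum>l\<in>L. D j l * w l)))))"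

text \<open>Schur complement of the pivot \<open>C p q\<close> with inverse \<open>c'\<close>: the
  matrix left after splitting off the trivial summand spanned by row \<open>p\<close> and column
  \<open>q\<close>.\<close>

definition schur :: "('a \<Rightarrow> 'b \<Rightarrow> 'r::comm_ring_1) \<Rightarrow> 'r \<Rightarrow> 'a \<Rightarrow> 'b \<Rightarrow> 'a \<Rightarrow> 'b \<Rightarrow> 'r" where
  "schur C c' p q i k = C i k - c' * C i q * C p k"

text \<open>Subtracting a multiple of row \<open>p\<close> clears column \<open>q\<close>; hence on
  vectors killed by row \<open>p\<close> the matrix and its Schur complement agree.\<close>

lemma schur_eliminate:
  assumes "finite J" "q \<in> J" "C p q * c' = 1"
  shows "(\<Sum>k\<in>J. C i k * v k) = (\<Sum>k\<in>J - {q}. schur C c' p q i k * v k) + c' * C i q * (\<Sum>k\<in>J. C p k * v k)"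
proof -
  have "C i q * v q = c' * C i q * (C p q * v q)"
    using assms(3) by (simp add: mult.assoc mult.left_commute[of c'] mult.commute[of c'])
       (simp add: mult.assoc[symmetric] mult.commute)
  then show ?thesis
    unfolding sum.remove[OF assms(1,2)]
    by (simp add: schur_def left_diff_distrib sum_subtractf sum_distrib_left algebra_simps)
qed

lemma in_ker_fun_upd_0: "finite J \<Longrightarrow> p \<in> J \<Longrightarrow> in_ker I C J (u(p := 0)) = in_ker I C (J - {p}) u"
  by (simp add: in_ker_def sum.remove)

locale subring =
  fixes U :: "'r::comm_ring_1 set"
  assumes zero_in: "0 \<in> U" and one_in: "1 \<in> U"
    and add_in: "a \<in> U \<Longrightarrow> b \<in> U \<Longrightarrow> a + b \<in> U"
    and uminus_in: "a \<in> U \<Longrightarrow> - a \<in> U"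
    and mult_in: "a \<in> U \<Longrightarrow> b \<in> U \<Longrightarrow> a * b \<in> U"
begin

lemma diff_in: "a \<in> U \<Longrightarrow> b \<in> U \<Longrightarrow> a - b \<in> U"
  using add_in[of a "- b"] uminus_in[of b] by simp

lemma sum_in: "(\<And>x. x \<in> A \<Longrightarrow> g x \<in> U) \<Longrightarrow> (\<Sum>x\<in>A. g x) \<in> U"
  by (induction A rule: infinite_finite_induct) (auto intro: zero_in add_in)

lemma schur_in:
  assumes "C i k \<in> U" "c' \<in> U" "C i q \<in> U" "C p k \<in> U"
  shows "schur C c' p q i k \<in> U"
  unfolding schur_def using assms by (intro diff_in mult_in)

lemma exact_at_image:
  assumes "exact_at U K J D L" "\<And>j l. j \<in> J \<Longrightarrow> l \<in> L \<Longrightarrow> D j l \<in> U" "\<And>l. l \<in> L \<Longrightarrow> w l \<in> U"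
  shows "K (\<lambda>j. \<Sum>l\<in>L. D j l * w l)"
proof -
  have "\<forall>j\<in>J. (\<Sum>l\<in>L. D j l * w l) \<in> U"
    using assms by (auto intro!: sum_in mult_in)
  with assms(1)[unfolded exact_at_def, rule_format, of "\<lambda>j. \<Sum>l\<in>L. D j l * w l"]
  show ?thesis
    using assms(3) by blast
qed

text \<open>Boundaries are cycles; this is read off at the unit vector of index
  \<open>q\<close>.\<close>

lemma exact_at_comp_column:
  assumes "exact_at U (in_ker I C J) J D L" "\<And>j l. j \<in> J \<Longrightarrow> l \<in> L \<Longrightarrow> D j l \<in> U"
    and "finite L" "q \<in> L" "i \<in> I"
  shows "(\<Sum>j\<in>J. C i j * D j q) = 0"
proof -
  have "in_ker I C J (\<lambda>j. \<Sum>l\<in>L. D j l * (if l = q then 1 else 0))"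
    by (rule exact_at_image[OF assms(1,2)]) (auto intro: zero_in one_in)
  then show ?thesis
    using assms(3-) by (simp add: in_ker_def if_distrib[where f = "(*) _"] cong: if_cong)
qed

text \<open>The pivot sits in the incoming matrix. Boundaries can be used to clear the coordinate at
  \<open>p\<close>, so it suffices to look at cycles vanishing there.\<close>

lemma exact_at_pivot_out:
  assumes ex: "exact_at U K J D L" and fin: "finite L" and pq: "p \<in> J" "q \<in> L"
    and c': "D p q * c' = 1" "c' \<in> U" and DU: "\<And>l. l \<in> L \<Longrightarrow> D p l \<in> U"
  shows "exact_at U (\<lambda>u. K (u(p := 0))) (J - {p}) (schur D c' p q) (L - {q})"
  unfolding exact_at_def
proof (intro allI impI)
  fix u assume u: "\<forall>j\<in>J - {p}. u j \<in> U"
  then have "\<forall>j\<in>J. (u(p := 0)) j \<in> U" by (auto simp: zero_in)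
  then have K: "K (u(p := 0)) \<longleftrightarrow> (\<exists>w. (\<forall>l\<in>L. w l \<in> U) \<and> (\<forall>j\<in>J. (u(p := 0)) j = (\<Sum>l\<in>L. D j l * w l)))"
    using ex by (simp add: exact_at_def)
  note elim = schur_eliminate[where C = D and p = p and c' = c', OF fin pq(2) c'(1)]
  show "K (u(p := 0)) \<longleftrightarrow> (\<exists>w. (\<forall>l\<in>L - {q}. w l \<in> U) \<and>
      (\<forall>j\<in>J - {p}. u j = (\<Sum>l\<in>L - {q}. schur D c' p q j l * w l)))" (is "_ \<longleftrightarrow> ?R")
  proof
    assume "K (u(p := 0))"
    then obtain w where w: "\<forall>l\<in>L. w l \<in> U" "\<forall>j\<in>J. (u(p := 0)) j = (\<Sum>l\<in>L. D j l * w l)"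
      using K by blast
    then have p0: "(\<Sum>l\<in>L. D p l * w l) = 0" using pq by force
    have "u j = (\<Sum>l\<in>L - {q}. schur D c' p q j l * w l)" if "j \<in> J - {p}" for j
    proof -
      have "u j = (\<Sum>l\<in>L. D j l * w l)"
        using bspec[OF w(2), of j] that by simp
      then show ?thesis using elim[of j w] p0 by simp
    qed
    then show ?R using w by blast
  next
    assume ?R
    then obtain w where w: "\<forall>l\<in>L - {q}. w l \<in> U" "\<forall>j\<in>J - {p}. u j = (\<Sum>l\<in>L - {q}. schur D c' p q j l * w l)"
      by blast
    \<comment> \<open>The coefficient at \<open>q\<close> is the one that makes row \<open>p\<close>
      vanish; it exists because the pivot is a unit.\<close>
    define w' where "w' = w(q := - (c' * (\<Sum>l\<in>L - {q}. D p l * w l)))"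
    have w'_eq: "(\<Sum>l\<in>L - {q}. g l * w' l) = (\<Sum>l\<in>L - {q}. g l * w l)" for g
      by (intro sum.cong) (auto simp: w'_def)
    have "(\<Sum>l\<in>L. D p l * w' l) = D p q * w' q + (\<Sum>l\<in>L - {q}. D p l * w l)"
      using fin pq by (simp add: sum.remove w'_eq)
    also have "D p q * w' q = - (\<Sum>l\<in>L - {q}. D p l * w l)"
      using c'(1) by (simp add: w'_def mult.assoc[symmetric])
    finally have p0: "(\<Sum>l\<in>L. D p l * w' l) = 0" by simp
    have "(u(p := 0)) j = (\<Sum>l\<in>L. D j l * w' l)" if "j \<in> J" for j
      using that p0 elim[of j w'] w by (auto simp: w'_eq)
    moreover have "\<forall>l\<in>L. w' l \<in> U"
      using w c' DU by (auto simp: w'_def intro!: uminus_in mult_in sum_in)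
    ultimately show "K (u(p := 0))" using K by blast
  qed
qed

text \<open>The pivot sits in the outgoing matrix. Row \<open>p\<close> then determines the
  coordinate at \<open>q\<close> of a cycle from the others, so that coordinate can be
  forgotten.\<close>

lemma exact_at_pivot_in:
  assumes ex: "exact_at U (in_ker I C J) J D L" and fin: "finite J" and pq: "p \<in> I" "q \<in> J"
    and c': "C p q * c' = 1" "c' \<in> U" and CU: "\<And>j. j \<in> J \<Longrightarrow> C p j \<in> U"
    and DU: "\<And>j l. j \<in> J \<Longrightarrow> l \<in> L \<Longrightarrow> D j l \<in> U"
  shows "exact_at U (in_ker (I - {p}) (schur C c' p q) (J - {q})) (J - {q}) D L"
  unfolding exact_at_def
proof (intro allI impI)
  fix u assume u: "\<forall>j\<in>J - {q}. u j \<in> U"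
  note elim = schur_eliminate[where C = C and p = p and c' = c', OF fin pq(2) c'(1)]
  show "in_ker (I - {p}) (schur C c' p q) (J - {q}) u \<longleftrightarrow>
      (\<exists>w. (\<forall>l\<in>L. w l \<in> U) \<and> (\<forall>j\<in>J - {q}. u j = (\<Sum>l\<in>L. D j l * w l)))" (is "?A \<longleftrightarrow> ?R")
  proof
    assume A: ?A
    \<comment> \<open>The only possible value at \<open>q\<close> for which row \<open>p\<close>
      vanishes.\<close>
    define v where "v = u(q := - (c' * (\<Sum>k\<in>J - {q}. C p k * u k)))"
    have v_eq: "(\<Sum>k\<in>J - {q}. g k * v k) = (\<Sum>k\<in>J - {q}. g k * u k)" for g
      by (intro sum.cong) (auto simp: v_def)
    have "(\<Sum>k\<in>J. C p k * v k) = C p q * v q + (\<Sum>k\<in>J - {q}. C p k * u k)"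
      using fin pq by (simp add: sum.remove v_eq)
    also have "C p q * v q = - (\<Sum>k\<in>J - {q}. C p k * u k)"
      using c'(1) by (simp add: v_def mult.assoc[symmetric])
    finally have p0: "(\<Sum>k\<in>J. C p k * v k) = 0" by simp
    have "in_ker I C J v"
      unfolding in_ker_def
    proof
      fix i assume "i \<in> I"
      then show "(\<Sum>j\<in>J. C i j * v j) = 0"
        using p0 elim[of i v] A by (cases "i = p") (auto simp: v_eq in_ker_def)
    qed
    moreover have "\<forall>j\<in>J. v j \<in> U"
      using u c' CU by (auto simp: v_def intro!: uminus_in mult_in sum_in)
    ultimately obtain w where w: "\<forall>l\<in>L. w l \<in> U" "\<forall>j\<in>J. v j = (\<Sum>l\<in>L. D j l * w l)"
      using ex unfolding exact_at_def by blast
    have "u j = (\<Sum>l\<in>L. D j l * w l)" if "j \<in> J - {q}" for j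
    proof -
      have "u j = v j" using that by (simp add: v_def)
      then show ?thesis using w that by simp
    qed
    with w(1) show ?R by blast
  next
    assume ?R
    then obtain w where w: "\<forall>l\<in>L. w l \<in> U" "\<forall>j\<in>J - {q}. u j = (\<Sum>l\<in>L. D j l * w l)" by blast
    define v where "v = (\<lambda>j. \<Sum>l\<in>L. D j l * w l)"
    have "in_ker I C J v"
      unfolding v_def using w by (intro exact_at_image[OF ex DU]) auto
    then have v0: "(\<Sum>k\<in>J. C i k * v k) = 0" if "i \<in> I" for i
      using that by (simp add: in_ker_def)
    have "(\<Sum>k\<in>J - {q}. schur C c' p q i k * u k) = 0" if "i \<in> I" for i
    proof -
      have "(\<Sum>k\<in>J - {q}. schur C c' p q i k * u k) = (\<Sum>k\<in>J - {q}. schur C c' p q i k * v k)"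
        using w by (intro sum.cong) (auto simp: v_def)
      then show ?thesis using elim[of i v] v0[OF that] v0[OF pq(1)] by simp
    qed
    then show ?A by (auto simp: in_ker_def)
  qed
qed

text \<open>\<open>E\<close> annihilates the image of \<open>C\<close>, and \<open>E p q\<close> is
  a unit; so row \<open>q\<close> of \<open>C\<close> is a combination of its other rows on the
  vectors considered, and dropping it does not enlarge the kernel.\<close>

lemma exact_at_drop_row:
  assumes ex: "exact_at U (in_ker J C L) L D Z" and exE: "exact_at U (in_ker I E J) J C L"
    and fin: "finite J" and pq: "p \<in> I" "q \<in> J" and c': "E p q * c' = 1"
    and CU: "\<And>j l. j \<in> J \<Longrightarrow> l \<in> L \<Longrightarrow> C j l \<in> U"
  shows "exact_at U (in_ker (J - {q}) C L) L D Z"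
proof -
  have "in_ker J C L u \<longleftrightarrow> in_ker (J - {q}) C L u" if u: "\<forall>l\<in>L. u l \<in> U" for u
  proof
    assume A: "in_ker (J - {q}) C L u"
    have "in_ker I E J (\<lambda>j. \<Sum>l\<in>L. C j l * u l)"
      using u by (intro exact_at_image[OF exE CU]) auto
    then have "0 = (\<Sum>j\<in>J. E p j * (\<Sum>l\<in>L. C j l * u l))"
      using pq by (simp add: in_ker_def)
    also have "\<dots> = E p q * (\<Sum>l\<in>L. C q l * u l)"
      using fin pq A by (simp add: sum.remove in_ker_def)
    finally have "c' * (E p q * (\<Sum>l\<in>L. C q l * u l)) = 0" by simp
    then have "(\<Sum>l\<in>L. C q l * u l) = 0"
      using c' by (simp add: mult.assoc[symmetric] mult.commute)
    then show "in_ker J C L u" using A by (auto simp: in_ker_def)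
  qed (auto simp: in_ker_def)
  then show ?thesis using ex by (simp add: exact_at_def)
qed

text \<open>Column \<open>q\<close> of \<open>C\<close> is a relation between the columns of
  \<open>B\<close> with a unit coefficient at \<open>p\<close>, which makes column \<open>p\<close>
  of \<open>B\<close> redundant.\<close>

lemma exact_at_drop_column:
  assumes ex: "exact_at U K H B I" and fin: "finite I"
    and comp: "\<And>h. h \<in> H \<Longrightarrow> (\<Sum>i\<in>I. B h i * C i q) = 0"
    and p: "p \<in> I" and c': "C p q * c' = 1" "c' \<in> U" and CU: "\<And>i. i \<in> I \<Longrightarrow> C i q \<in> U"
  shows "exact_at U K H B (I - {p})"
proof -
  have "(\<exists>w. (\<forall>l\<in>I. w l \<in> U) \<and> (\<forall>j\<in>H. u j = (\<Sum>l\<in>I. B j l * w l))) \<longleftrightarrow>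
        (\<exists>w. (\<forall>l\<in>I - {p}. w l \<in> U) \<and> (\<forall>j\<in>H. u j = (\<Sum>l\<in>I - {p}. B j l * w l)))" (is "?A \<longleftrightarrow> ?R") for u
  proof
    assume ?A
    then obtain w where w: "\<forall>l\<in>I. w l \<in> U" "\<forall>j\<in>H. u j = (\<Sum>l\<in>I. B j l * w l)" by blast
    \<comment> \<open>The multiple of the relation that brings the coefficient at \<open>p\<close>
      to zero.\<close>
    define w' where "w' i = w i - w p * c' * C i q" for i
    have "\<forall>l\<in>I - {p}. w' l \<in> U"
      unfolding w'_def using w p c' CU
      by (auto intro!: diff_in mult_in)
    moreover have "u j = (\<Sum>l\<in>I - {p}. B j l * w' l)" if "j \<in> H" for j
    proof -
      have "w' p = 0"
        using c'(1) by (simp add: w'_def mult.assoc mult.commute[of c'])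
      then have "(\<Sum>l\<in>I - {p}. B j l * w' l) = (\<Sum>l\<in>I. B j l * w' l)"
        using fin p by (simp add: sum.remove)
      also have "\<dots> = (\<Sum>l\<in>I. B j l * w l) - w p * c' * (\<Sum>l\<in>I. B j l * C l q)"
        by (simp add: w'_def right_diff_distrib sum_subtractf sum_distrib_left algebra_simps)
      finally show ?thesis using w comp that by simp
    qed
    ultimately show ?R by blast
  next
    assume ?R
    then obtain w where w: "\<forall>l\<in>I - {p}. w l \<in> U" "\<forall>j\<in>H. u j = (\<Sum>l\<in>I - {p}. B j l * w l)" by blast
    have "(\<Sum>l\<in>I. B j l * (w(p := 0)) l) = (\<Sum>l\<in>I - {p}. B j l * w l)" for j
      using fin p by (simp add: sum.remove)
    then show ?A using w by (intro exI[of _ "w(p := 0)"]) (auto simp: zero_in)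
  qed
  then show ?thesis using ex by (simp add: exact_at_def)
qed

text \<open>The matrix D d maps the free module on I (d + 1) to the one on I d; the
  augmentation of the complex is the coordinatewise map g followed by the row vector a.\<close>

definition resolution ::
  "('r \<Rightarrow> 's::comm_ring_1) \<Rightarrow> ('a \<Rightarrow> 's) \<Rightarrow> (nat \<Rightarrow> 'a set) \<Rightarrow> (nat \<Rightarrow> 'a \<Rightarrow> 'a \<Rightarrow> 'r) \<Rightarrow> bool" where
  "resolution g a I D \<longleftrightarrow> (\<forall>d. finite (I d)) \<and> (\<forall>d. \<forall>i\<in>I d. \<forall>k\<in>I (Suc d). D d i k \<in> U) \<and>
     exact_at U (\<lambda>u. (\<Sum>k\<in>I 0. a k * g (u k)) = 0) (I 0) (D 0) (I 1) \<and>
     (\<forall>d. exact_at U (in_ker (I d) (D d) (I (Suc d))) (I (Suc d)) (D (Suc d)) (I (Suc (Suc d))))"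

text \<open>Only the matrices next to the pivot are touched: \<open>D d\<close> becomes its Schur
  complement, the matrix before it loses column \<open>p\<close>, the one after it loses row
  \<open>q\<close>. Each position of the pivot relative to a spot of the complex is settled by one
  of the four preceding lemmas or is trivial.\<close>

lemma resolution_cancel:
  assumes res: "resolution g a I D" and g: "g 0 = 0" "\<And>x y. g (x + y) = g x + g y"
    and pq: "p \<in> I d" "q \<in> I (Suc d)" and c': "D d p q * c' = 1" "c' \<in> U"
  shows "resolution g a (I(d := I d - {p}, Suc d := I (Suc d) - {q})) (D(d := schur (D d) c' p q))"
    (is "resolution g a ?I ?D")
proof -
  have fin: "finite (I e)" for e using res by (simp add: resolution_def)
  have DU: "\<And>i k. i \<in> I e \<Longrightarrow> k \<in> I (Suc e) \<Longrightarrow> D e i k \<in> U" for e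
    using res by (simp add: resolution_def)
  have ex0: "exact_at U (\<lambda>u. (\<Sum>k\<in>I 0. a k * g (u k)) = 0) (I 0) (D 0) (I 1)"
    using res by (simp add: resolution_def)
  have ex: "exact_at U (in_ker (I e) (D e) (I (Suc e))) (I (Suc e)) (D (Suc e)) (I (Suc (Suc e)))" for e
    using res by (simp add: resolution_def)
  have "exact_at U (\<lambda>u. (\<Sum>k\<in>?I 0. a k * g (u k)) = 0) (?I 0) (?D 0) (?I 1)"
  proof -
    consider "d = 0" | "d = 1" | "d \<ge> 2" by linarith
    then show ?thesis
    proof cases
      case 1
      \<comment> \<open>The pivot removes a generator in degree 0, and the augmentation is merely
        restricted to the remaining ones.\<close>
      have "(\<Sum>k\<in>I 0. a k * g ((u(p := 0)) k)) = (\<Sum>k\<in>I 0 - {p}. a k * g (u k))" for u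
        using pq fin[of 0] 1 by (simp add: sum.remove g)
      then show ?thesis
        using exact_at_pivot_out[OF ex0 fin pq[unfolded 1, folded One_nat_def], of c'] 1 c' DU[of _ 0] pq
        by (simp add: fun_upd_def)
    next
      case 2
      have "exact_at U (\<lambda>u. (\<Sum>k\<in>I 0. a k * g (u k)) = 0) (I 0) (D 0) (I 1 - {p})"
        using pq 2 c' DU[of _ 1 q] exact_at_comp_column[OF ex[of 0] DU fin]
        by (intro exact_at_drop_column[OF ex0 fin, where C = "D 1" and q = q and c' = c']) auto
      then show ?thesis using 2 by simp
    next
      case 3
      then show ?thesis using ex0 by simp
    qed
  qed
  moreover have "exact_at U (in_ker (?I e) (?D e) (?I (Suc e))) (?I (Suc e)) (?D (Suc e)) (?I (Suc (Suc e)))" for e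
  proof -
    consider "d = Suc e" | "d = e" | "e = Suc d" | "d = Suc (Suc e)" | "d < e" "e \<noteq> Suc d" | "d > Suc (Suc e)"
      by linarith
    then show ?thesis
    proof cases
      case 1
      show ?thesis
        using exact_at_pivot_out[OF ex[of e] fin pq[unfolded 1], of c'] 1 c' DU[of _ d] pq fin[of d]
        by (simp add: in_ker_fun_upd_0)
    next
      case 2
      show ?thesis
        using exact_at_pivot_in[OF ex[of e] fin pq[unfolded 2], of c'] 2 c' DU pq by simp
    next
      case 3
      show ?thesis
        using exact_at_drop_row[OF ex[of e] ex[of d, folded 3] fin[of e] pq[folded 3] c'(1)] 3 DU pq by simp
    next
      case 4
      have "exact_at U (in_ker (I e) (D e) (I (Suc e))) (I (Suc e)) (D (Suc e)) (I d - {p})"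
        using pq 4 c' DU[of _ d q] exact_at_comp_column[OF ex[of "Suc e"] DU fin]
        by (intro exact_at_drop_column[OF ex[of e, folded 4] fin, where C = "D d" and q = q and c' = c']) auto
      then show ?thesis using 4 by simp
    next
      case 5 then show ?thesis using ex[of e] by simp
    next
      case 6 then show ?thesis using ex[of e] by simp
    qed
  qed
  moreover have "?D e i k \<in> U" if "i \<in> ?I e" "k \<in> ?I (Suc e)" for e i k
    using that DU pq c' by (auto split: if_splits intro!: schur_in)
  ultimately show ?thesis
    using fin unfolding resolution_def by auto
qed

end

subsection \<open>The Apery ring as a module over the polynomial ring\<close>

definition exp_le :: "nat \<Rightarrow> nat \<Rightarrow> (nat, 'k::zero) mpoly \<Rightarrow> bool" where
  "exp_le k N f \<longleftrightarrow> (\<forall>mu\<in>Poly_Mapping.keys f. Poly_Mapping.lookup mu k \<le> N)"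

lemma exists_exp_le: "\<exists>N. exp_le k N f"
  by (intro exI[of _ "Max ((\<lambda>mu. Poly_Mapping.lookup mu k) ` Poly_Mapping.keys f)"])
     (auto simp: exp_le_def)

lemma vars_in_Suc_iff: "vars_in {..k} f \<longleftrightarrow> vars_in {..Suc k} f \<and> exp_le (Suc k) 0 f"
  (is "?A \<longleftrightarrow> ?B")
proof
  assume A: ?A
  have "Poly_Mapping.lookup mu (Suc k) = 0" if "mu \<in> Poly_Mapping.keys f" for mu
  proof -
    have "Suc k \<notin> Poly_Mapping.keys mu"
      using A that by (fastforce simp: vars_in_def)
    then show ?thesis by (simp add: in_keys_iff)
  qed
  then show ?B using vars_in_mono[OF A] by (auto simp: exp_le_def)
next
  assume B: ?B
  show ?A
    unfolding vars_in_def
  proof (intro ballI subsetI)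
    fix mu v assume mu: "mu \<in> Poly_Mapping.keys f" and v: "v \<in> Poly_Mapping.keys mu"
    then have "v \<le> Suc k" "Poly_Mapping.lookup mu (Suc k) = 0"
      using B by (auto simp: vars_in_def exp_le_def)
    with v have "v \<noteq> Suc k" "v \<le> Suc k"
      by (auto simp: in_keys_iff)
    then show "v \<in> {..k}" by auto
  qed
qed

lemma lookup_Var_mult_add:
  fixes f :: "('v, 'k::comm_ring_1) mpoly"
  shows "Poly_Mapping.lookup (Var v * f) (Poly_Mapping.single v 1 + mu) = Poly_Mapping.lookup f mu"
proof (induction f rule: poly_mapping_add_induct)
  case (single nu c)
  show ?case
    by (auto simp: Var_def mult_single lookup_single when_def)
qed (auto simp: lookup_add algebra_simps)

lemma split_off_Var:
  fixes f :: "(nat, 'k::comm_ring_1) mpoly"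
  assumes "vars_in {..Suc k} f" "exp_le (Suc k) (Suc N) f"
  shows "\<exists>g h. f = g + Var (Suc k) * h \<and> vars_in {..k} g \<and> vars_in {..Suc k} h \<and> exp_le (Suc k) N h"
proof -
  let ?l = "\<lambda>mu. Poly_Mapping.lookup mu (Suc k)"
  let ?e = "Poly_Mapping.single (Suc k) (1::nat)"
  let ?s = "\<lambda>mu. Poly_Mapping.single mu (Poly_Mapping.lookup f mu)"
  define A where "A = {mu \<in> Poly_Mapping.keys f. ?l mu = 0}"
  define B where "B = {mu \<in> Poly_Mapping.keys f. ?l mu \<noteq> 0}"
  define g where "g = (\<Sum>mu\<in>A. ?s mu)"
  \<comment> \<open>Subtraction of exponents truncates, but every exponent in \<open>B\<close>
    contains the variable, so here it is exact division.\<close>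
  define h where "h = (\<Sum>mu\<in>B. Poly_Mapping.single (mu - ?e) (Poly_Mapping.lookup f mu))"
  have "Var (Suc k) * h = (\<Sum>mu\<in>B. ?s mu)"
    unfolding h_def sum_distrib_left
  proof (intro sum.cong refl)
    fix mu assume "mu \<in> B"
    then have "?e + (mu - ?e) = mu"
      by (intro poly_mapping_eqI) (auto simp: lookup_add lookup_minus lookup_single when_def B_def)
    then show "Var (Suc k) * Poly_Mapping.single (mu - ?e) (Poly_Mapping.lookup f mu) = ?s mu"
      by (simp add: Var_def mult_single)
  qed
  moreover have "(\<Sum>mu\<in>A \<union> B. ?s mu) = (\<Sum>mu\<in>A. ?s mu) + (\<Sum>mu\<in>B. ?s mu)"
    by (intro sum.union_disjoint) (auto simp: A_def B_def)
  moreover have "A \<union> B = Poly_Mapping.keys f" by (auto simp: A_def B_def)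
  ultimately have "g + Var (Suc k) * h = f"
    using poly_mapping_sum_singles[of f, symmetric] by (simp add: g_def)
  moreover have "Poly_Mapping.keys g \<subseteq> A"
    unfolding g_def by (rule order.trans[OF keys_sum]) (auto split: if_splits)
  moreover have "Poly_Mapping.keys h \<subseteq> (\<lambda>mu. mu - ?e) ` B"
    unfolding h_def by (rule order.trans[OF keys_sum]) (auto split: if_splits)
  moreover have "Poly_Mapping.keys (mu - ?e) \<subseteq> Poly_Mapping.keys mu" for mu
    by (auto simp: in_keys_iff lookup_minus)
  ultimately have *: "g + Var (Suc k) * h = f" "Poly_Mapping.keys g \<subseteq> A"
    "Poly_Mapping.keys h \<subseteq> (\<lambda>mu. mu - ?e) ` B" "\<And>mu. Poly_Mapping.keys (mu - ?e) \<subseteq> Poly_Mapping.keys mu"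
    by auto
  have "vars_in {..Suc k} h"
    unfolding vars_in_def
  proof
    fix nu assume "nu \<in> Poly_Mapping.keys h"
    then obtain mu where "mu \<in> B" "nu = mu - ?e" using *(3) by blast
    then show "Poly_Mapping.keys nu \<subseteq> {..Suc k}"
      using assms(1) *(4)[of mu] unfolding B_def vars_in_def by blast
  qed
  moreover have "exp_le (Suc k) N h"
    unfolding exp_le_def
  proof
    fix nu assume "nu \<in> Poly_Mapping.keys h"
    then obtain mu where "mu \<in> B" "nu = mu - ?e" using *(3) by blast
    then show "?l nu \<le> N"
      using assms(2) by (auto simp: B_def exp_le_def lookup_minus)
  qed
  moreover have "vars_in {..k} g"
    unfolding vars_in_Suc_iff[of k] using *(2) assms(1) by (auto simp: A_def vars_in_def exp_le_def)
  ultimately show ?thesis using *(1) by blast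
qed

definition toric :: "nat set \<Rightarrow> (nat, 'k::field) mpoly \<Rightarrow> 'k poly" where
  "toric S = subst (\<lambda>v. monom 1 (apery S v)) (\<lambda>c. [:c:])"

lemma toric_simps:
  "toric S 0 = 0" "toric S 1 = 1" "toric S (f + g) = toric S f + toric S g"
  "toric S (f - g) = toric S f - toric S g" "toric S (- f) = - toric S f"
  "toric S (f * g) = toric S f * toric S g" "toric S (f ^ n) = toric S f ^ n"
  "toric S (Var v) = monom 1 (apery S v)"
  by (simp_all add: toric_def poly_const_hom.subst_add poly_const_hom.subst_diff
      poly_const_hom.subst_uminus poly_const_hom.subst_mult poly_const_hom.subst_power
      poly_const_hom.subst_Var)

text \<open>A monomial goes to \<open>t\<close> raised to its weight. The sums in the definition of
  \<open>apery_ideal\<close> are therefore coefficients of the image, and \<open>apery_ideal\<close>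
  is the kernel of \<open>toric\<close>.\<close>

lemma coeff_toric:
  "coeff (toric S f) n = (\<Sum>mu | mu \<in> Poly_Mapping.keys f \<and> wdeg S mu = n. Poly_Mapping.lookup f mu)"
proof -
  have "monom_val (\<lambda>v. monom 1 (apery S v)) mu = monom (1::'a) (wdeg S mu)" for mu
  proof -
    have prod_monom: "(\<Prod>w\<in>A. monom (1::'a) (h w)) = monom 1 (\<Sum>w\<in>A. h w)" for A and h :: "nat \<Rightarrow> nat"
      by (induction A rule: infinite_finite_induct) (auto simp: mult_monom)
    show ?thesis
      by (simp add: monom_val_def monom_power prod_monom wdeg_def mult.commute)
  qed
  then have "toric S f = (\<Sum>mu\<in>Poly_Mapping.keys f. monom (Poly_Mapping.lookup f mu) (wdeg S mu))"
    by (simp add: toric_def subst_monom_val smult_monom)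
  then show ?thesis
    by (simp add: coeff_sum sum.inter_filter)
qed

lemma apery_ideal_iff: "f \<in> apery_ideal S \<longleftrightarrow> inR (multiplicity S) f \<and> toric S f = 0"
  by (auto simp: apery_ideal_def poly_eq_iff coeff_toric)

section \<open>Apery numbers and the multiplication table of \<open>A\<close>\<close>

locale mult_semigroup =
  fixes S :: "nat set" and m :: nat
  assumes semigroup: "numerical_semigroup S" and mult: "multiplicity S = m"
begin

lemma add_closed: "a \<in> S \<Longrightarrow> b \<in> S \<Longrightarrow> a + b \<in> S"
  using semigroup by (auto simp: numerical_semigroup_def)

lemma zero_mem: "0 \<in> S"
  using semigroup by (auto simp: numerical_semigroup_def)

lemma eventually_mem: "\<exists>N. \<forall>n\<ge>N. n \<in> S"
proof -
  have "finite (UNIV - S)" using semigroup by (simp add: numerical_semigroup_def)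
  then obtain N where "\<forall>n\<in>UNIV - S. n < N" by (metis finite_nat_set_iff_bounded)
  then show ?thesis by (metis DiffI UNIV_I not_less)
qed

lemma m_pos: "m > 0"
proof -
  obtain N where "\<forall>n\<ge>N. n \<in> S" using eventually_mem by blast
  then have "Suc N \<in> S \<and> Suc N \<noteq> 0" by auto
  then have "m \<in> S \<and> m \<noteq> 0"
    using LeastI[of "\<lambda>n. n \<in> S \<and> n \<noteq> 0" "Suc N"] mult by (simp add: multiplicity_def)
  then show ?thesis by auto
qed

text \<open>Differs from \<open>apery\<close> in residue class 0, where it gives 0 and not
  \<open>m\<close>: it is the degree of the \<open>k[y]\<close>-basis element of index
  \<open>j\<close> of \<open>A\<close>, with the element of index 0 equal to 1.\<close>

definition s :: "nat \<Rightarrow> nat" where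
  "s j = (LEAST n. n \<in> S \<and> n mod m = j mod m)"

lemma s_mem: "s j \<in> S" and s_mod: "s j mod m = j mod m"
proof -
  obtain N where "\<forall>n\<ge>N. n \<in> S" using eventually_mem by blast
  then have "j + m * N \<in> S \<and> (j + m * N) mod m = j mod m"
    using m_pos by (simp add: trans_le_add2)
  then have "s j \<in> S \<and> s j mod m = j mod m"
    unfolding s_def by (rule LeastI)
  then show "s j \<in> S" "s j mod m = j mod m" by auto
qed

lemma s_le: "n \<in> S \<Longrightarrow> n mod m = j mod m \<Longrightarrow> s j \<le> n"
  unfolding s_def by (rule Least_le) auto

lemma s_0: "s 0 = 0"
  using s_le[of 0 0] zero_mem by simp

lemma apery_eq: "apery S i = (if i mod m = 0 then m else s i)"
  by (simp add: apery_def mult s_def)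

lemma apery_pos: "apery S i > 0"
proof (cases "i mod m = 0")
  case False
  then have "s i \<noteq> 0" using s_mod[of i] by (metis mod_0)
  then show ?thesis using False by (simp add: apery_eq)
qed (simp add: apery_eq m_pos)

lemma apery_mod: "apery S i mod m = i mod m"
  by (simp add: apery_eq s_mod)

text \<open>The exponent of \<open>y\<close> when \<open>x_i\<close> multiplies the basis element of
  index \<open>j\<close> of \<open>A\<close>. The choice of \<open>b_coef\<close> over
  \<open>c_coef\<close> accounts for the product landing on 1 and not on \<open>x_0 = y\<close> when
  \<open>i + j\<close> is divisible by \<open>m\<close>.\<close>

definition beta :: "nat \<Rightarrow> nat \<Rightarrow> nat" where
  "beta i j = (if j = 0 then 0 else b_coef S i j)"

lemma beta_apery:
  assumes "1 \<le> i" "i < m" "j < m"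
  shows "m * beta i j + s ((i + j) mod m) = apery S i + s j"
proof (cases "j = 0")
  case True
  then show ?thesis using assms by (simp add: beta_def s_0 apery_eq)
next
  case False
  then have ap: "apery S i = s i" "apery S j = s j"
    using assms by (auto simp: apery_eq)
  have mem: "apery S i + apery S j \<in> S"
    using ap s_mem add_closed by simp
  have md: "(apery S i + apery S j) mod m = (i + j) mod m"
    using apery_mod[of i] apery_mod[of j] by (metis mod_add_eq)
  show ?thesis
  proof (cases "(i + j) mod m = 0")
    case True
    then have "m dvd apery S i + apery S j" using md by auto
    \<comment> \<open>A positive multiple of \<open>m\<close>, so the subtraction of
      \<open>apery S 0 = m\<close> inside \<open>c_coef\<close> does not truncate.\<close>
    moreover have "m \<le> apery S i + apery S j"
      using calculation apery_pos[of i] by (intro dvd_imp_le) auto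
    ultimately have "m * c_coef S i j + m = apery S i + apery S j"
      using True by (simp add: c_coef_def mult apery_eq[of 0] dvd_minus_self)
    then show ?thesis
      using True False ap by (simp add: beta_def b_coef_def mult s_0 algebra_simps)
  next
    case nz: False
    have eq: "apery S ((i + j) mod m) = s ((i + j) mod m)"
      using nz by (simp add: apery_eq)
    have le: "s ((i + j) mod m) \<le> apery S i + apery S j"
      using mem md by (intro s_le) auto
    have "m dvd apery S i + apery S j - s ((i + j) mod m)"
      using md s_mod[of "(i + j) mod m"] by (subst mod_eq_dvd_iff_nat[OF le, symmetric]) simp
    then have "m * c_coef S i j + s ((i + j) mod m) = apery S i + apery S j"
      using le by (simp add: c_coef_def mult eq)
    then show ?thesis
      using nz False ap by (simp add: beta_def b_coef_def mult)
  qed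
qed

lemma b_coef_pos: "(i + j) mod m = 0 \<Longrightarrow> b_coef S i j > 0"
  by (simp add: b_coef_def mult)

lemma wdeg_eq_0_iff: "wdeg S mu = 0 \<longleftrightarrow> mu = 0"
proof
  assume "wdeg S mu = 0"
  then have "\<forall>v\<in>Poly_Mapping.keys mu. Poly_Mapping.lookup mu v = 0"
    using apery_pos by (auto simp: wdeg_def) (metis not_less0)
  then show "mu = 0"
    by (intro poly_mapping_eqI) (auto simp: in_keys_iff)
qed (simp add: wdeg_def)

text \<open>All weights are positive, so only the empty monomial contributes. In particular elements
  of \<open>J_S\<close> have no constant term.\<close>

lemma coeff_toric_0: "coeff (toric S f) 0 = cterm f"
proof -
  have "{mu. mu \<in> Poly_Mapping.keys f \<and> wdeg S mu = 0} = (if cterm f = 0 then {} else {0})"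
    by (auto simp: wdeg_eq_0_iff cterm_def in_keys_iff)
  then show ?thesis by (simp add: coeff_toric) (simp add: cterm_def)
qed

text \<open>Multiplication by $x_i$ on $R/J_S$ sends the $k[y]$-basis element of index $\sigma_i(j)$ to a
  multiple of the one of index $j$.\<close>

definition sigma :: "nat \<Rightarrow> nat \<Rightarrow> nat" where
  "sigma i j = (j + (m - i)) mod m"

lemma sigma_less: "sigma i j < m"
  using m_pos by (simp add: sigma_def)

lemma add_sigma: "i < m \<Longrightarrow> j < m \<Longrightarrow> (i + sigma i j) mod m = j"
  by (simp add: sigma_def mod_add_right_eq)

lemma sigma_add: "i < m \<Longrightarrow> j < m \<Longrightarrow> sigma i ((i + j) mod m) = j"
  unfolding sigma_def mod_add_left_eq by simp

lemma sigma_commute: "sigma i (sigma k j) = sigma k (sigma i j)"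
  unfolding sigma_def mod_add_left_eq by (simp only: add_ac)

lemma beta_sigma:
  assumes "1 \<le> i" "i < m" "j < m"
  shows "m * beta i (sigma i j) + s j = apery S i + s (sigma i j)"
  using beta_apery[of i "sigma i j"] assms sigma_less by (simp add: add_sigma)

text \<open>Commutativity of multiplication by \<open>x_i\<close> and \<open>x_k\<close> on
  \<open>A\<close>, seen in degrees: \<open>m\<close> times either side, plus \<open>s j\<close>, is
  the degree of \<open>x_i x_k\<close> times the source basis element.\<close>

lemma beta_commute:
  assumes "1 \<le> i" "i < m" "1 \<le> k" "k < m" "j < m"
  shows "beta i (sigma i j) + beta k (sigma k (sigma i j)) = beta k (sigma k j) + beta i (sigma i (sigma k j))"
proof -
  have "m * (beta i (sigma i j) + beta k (sigma k (sigma i j))) + s j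
      = m * (beta k (sigma k j) + beta i (sigma i (sigma k j))) + s j"
    using beta_sigma[of i j] beta_sigma[of k "sigma i j"] beta_sigma[of k j] beta_sigma[of i "sigma k j"]
      assms sigma_less sigma_commute[of i k j] by (simp add: distrib_left)
  then show ?thesis using m_pos by simp
qed

text \<open>An element of $R \otimes_{k[y]} A$ is encoded by its coordinates $u_j$, $j < m$, in the basis
  $1, x_1, \dots, x_{m-1}$ of $A$. Then endo i is $x_i \otimes 1 - 1 \otimes x_i$, mods k is
  $k[y, x_1, \dots, x_k] \otimes_{k[y]} A$, and aug is the multiplication map into $A \subseteq k[t]$.\<close>

definition shifted :: "nat \<Rightarrow> (nat \<Rightarrow> (nat, 'k::field) mpoly) \<Rightarrow> nat \<Rightarrow> (nat, 'k) mpoly" where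
  "shifted i u j = (if j < m then Var 0 ^ beta i (sigma i j) * u (sigma i j) else 0)"

definition endo :: "nat \<Rightarrow> (nat \<Rightarrow> (nat, 'k::field) mpoly) \<Rightarrow> nat \<Rightarrow> (nat, 'k) mpoly" where
  "endo i u j = Var i * u j - shifted i u j"

definition mods :: "nat \<Rightarrow> (nat \<Rightarrow> (nat, 'k::field) mpoly) set" where
  "mods k = {u. (\<forall>j\<ge>m. u j = 0) \<and> (\<forall>j. vars_in {..k} (u j))}"

definition aug :: "(nat \<Rightarrow> (nat, 'k::field) mpoly) \<Rightarrow> 'k poly" where
  "aug u = (\<Sum>j<m. monom 1 (s j) * toric S (u j))"

lemma shifted_shifted:
  assumes "1 \<le> i" "i < m" "1 \<le> k" "k < m"
  shows "shifted i (shifted k u) = shifted k (shifted i u)"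
proof
  fix j
  show "shifted i (shifted k u) j = shifted k (shifted i u) j"
  proof (cases "j < m")
    case True
    then show ?thesis
      using beta_commute[OF assms True] sigma_less
      by (simp add: shifted_def sigma_commute[of i k j] mult.assoc[symmetric] power_add[symmetric])
  qed (simp add: shifted_def)
qed

lemma endo_commute:
  assumes "1 \<le> i" "i < m" "1 \<le> k" "k < m"
  shows "endo i (endo k u) = endo k (endo i u)"
proof
  fix j
  have lin: "shifted i (endo k u) j = Var k * shifted i u j - shifted i (shifted k u) j" for i k
    by (simp add: shifted_def[of i] endo_def algebra_simps)
  have "endo i (endo k u) j = Var i * (Var k * u j - shifted k u j) - (Var k * shifted i u j - shifted i (shifted k u) j)"
    by (simp add: endo_def[of i] lin) (simp add: endo_def)
  also have "\<dots> = Var k * (Var i * u j - shifted i u j) - (Var i * shifted k u j - shifted k (shifted i u) j)"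
    by (simp add: shifted_shifted[OF assms] algebra_simps)
  also have "\<dots> = endo k (endo i u) j"
    by (simp add: endo_def[of k] lin) (simp add: endo_def)
  finally show "endo i (endo k u) j = endo k (endo i u) j" .
qed

text \<open>\<open>x_i \<otimes> 1\<close> and \<open>1 \<otimes> x_i\<close> have the same product
  in \<open>A\<close>. In coordinates the two sums differ by the permutation \<open>sigma i\<close>
  of the residues.\<close>

lemma aug_endo:
  assumes "1 \<le> i" "i < m"
  shows "aug (endo i u) = 0"
proof -
  let ?g = "\<lambda>j. monom 1 (apery S i + s j) * toric S (u j)"
  have "monom 1 (s j) * toric S (endo i u j) = ?g j - ?g (sigma i j)" if j: "j < m" for j
  proof -
    have "toric S (endo i u j) = monom 1 (apery S i) * toric S (u j)
        - monom 1 (m * beta i (sigma i j)) * toric S (u (sigma i j))"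
      using j by (simp add: endo_def shifted_def toric_simps monom_power apery_eq[of 0])
    then show ?thesis
      using beta_sigma[OF assms j]
      by (simp add: right_diff_distrib mult.assoc[symmetric] mult_monom add.commute)
  qed
  then have "aug (endo i u) = (\<Sum>j<m. ?g j) - (\<Sum>j<m. ?g (sigma i j))"
    by (simp add: aug_def sum_subtractf)
  also have "(\<Sum>j<m. ?g (sigma i j)) = (\<Sum>j<m. ?g j)"
    using assms sigma_less m_pos
    by (intro sum.reindex_bij_witness[of _ "\<lambda>j. (i + j) mod m" "sigma i"]) (auto simp: add_sigma sigma_add)
  finally show ?thesis by simp
qed

lemma vars_in_y_key:
  assumes "vars_in {..0} f" "mu \<in> Poly_Mapping.keys f"
  shows "mu = Poly_Mapping.single (0::nat) (Poly_Mapping.lookup mu 0)"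
proof (rule poly_mapping_eqI)
  fix v
  have "v \<in> Poly_Mapping.keys mu \<Longrightarrow> v = 0" using assms by (auto simp: vars_in_def)
  then show "Poly_Mapping.lookup mu v = Poly_Mapping.lookup (Poly_Mapping.single 0 (Poly_Mapping.lookup mu 0)) v"
    by (auto simp: lookup_single when_def in_keys_iff)
qed

lemma coeff_toric_y:
  assumes "vars_in {..0} f"
  shows "coeff (toric S f) n = (if m dvd n then Poly_Mapping.lookup f (Poly_Mapping.single 0 (n div m)) else 0)"
proof -
  note mono = vars_in_y_key[OF assms]
  have wd: "wdeg S (Poly_Mapping.single 0 k) = k * m" for k
    by (cases "k = 0") (auto simp: wdeg_def apery_eq)
  have "{mu. mu \<in> Poly_Mapping.keys f \<and> wdeg S mu = n} =
     (if m dvd n \<and> Poly_Mapping.lookup f (Poly_Mapping.single 0 (n div m)) \<noteq> 0 then {Poly_Mapping.single 0 (n div m)} else {})"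
    (is "?L = ?R")
  proof (intro set_eqI iffI)
    fix mu assume mu: "mu \<in> ?L"
    then have "wdeg S (Poly_Mapping.single 0 (Poly_Mapping.lookup mu 0)) = n"
      using mono[of mu] by simp
    then have "n = Poly_Mapping.lookup mu 0 * m" by (simp add: wd)
    then have "mu = Poly_Mapping.single 0 (n div m)" "m dvd n"
      using mono[of mu] mu m_pos by auto
    then show "mu \<in> ?R" using mu by (auto simp: in_keys_iff)
  next
    fix mu assume "mu \<in> ?R"
    then show "mu \<in> ?L" by (auto split: if_splits simp: wd in_keys_iff)
  qed
  then show ?thesis by (simp add: coeff_toric)
qed

text \<open>Independence of the basis over \<open>k[y]\<close>: the numbers \<open>s j\<close> lie
  in distinct residue classes and \<open>y\<close> has degree \<open>m\<close>, so each power of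
  \<open>t\<close> receives a contribution from only one coordinate.\<close>

lemma aug_inj:
  assumes "u \<in> mods 0" "aug u = 0"
  shows "u = 0"
proof
  fix j
  show "u j = 0 j"
  proof (cases "j < m")
    case True
    have vars: "vars_in {..0} (u i)" for i using assms(1) by (simp add: mods_def)
    have coeff0: "Poly_Mapping.lookup (u j) (Poly_Mapping.single 0 n) = 0" for n
    proof -
      have "coeff (monom 1 (s i) * toric S (u i)) (m * n + s j) =
        (if i = j then Poly_Mapping.lookup (u j) (Poly_Mapping.single 0 n) else 0)" if i: "i < m" for i
      proof (cases "i = j")
        case True
        then show ?thesis using m_pos by (simp add: coeff_monom_mult coeff_toric_y[OF vars])
      next
        case False
        have "\<not> m dvd m * n + s j - s i" if "s i \<le> m * n + s j"
        proof
          assume "m dvd m * n + s j - s i"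
          then have "(m * n + s j) mod m = s i mod m"
            using mod_eq_dvd_iff_nat[OF that, of m] by blast
          then show False using False i True s_mod[of i] s_mod[of j] by simp
        qed
        then show ?thesis using False by (auto simp: coeff_monom_mult coeff_toric_y[OF vars])
      qed
      then have "coeff (aug u) (m * n + s j) = (\<Sum>i<m. if i = j then Poly_Mapping.lookup (u j) (Poly_Mapping.single 0 n) else 0)"
        by (simp add: aug_def coeff_sum)
      then show ?thesis using True assms(2) by simp
    qed
    have "Poly_Mapping.keys (u j) = {}"
    proof (rule ccontr)
      assume "Poly_Mapping.keys (u j) \<noteq> {}"
      then obtain mu where mu: "mu \<in> Poly_Mapping.keys (u j)" by blast
      then have "mu = Poly_Mapping.single 0 (Poly_Mapping.lookup mu 0)"
        using vars_in_y_key[OF vars] by blast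
      then show False using coeff0 mu by (metis in_keys_iff)
    qed
    then show ?thesis by simp
  next
    case False
    then show ?thesis using assms(1) by (simp add: mods_def)
  qed
qed

lemma vars_in_shifted: "(\<And>j. vars_in {..k} (u j)) \<Longrightarrow> vars_in {..k} (shifted i u j)"
  by (auto simp: shifted_def intro!: vars_in_mult vars_in_power vars_in_Var)

lemma endo_mods: "i \<le> k \<Longrightarrow> u \<in> mods k \<Longrightarrow> endo i u \<in> mods k"
  by (auto simp: mods_def endo_def intro!: vars_in_diff vars_in_mult vars_in_Var vars_in_shifted)
     (simp add: shifted_def)

lemma endo_add: "endo i (u + v) = endo i u + endo i v"
  by (auto simp: endo_def shifted_def algebra_simps)

lemma mods_add: "u \<in> mods k \<Longrightarrow> v \<in> mods k \<Longrightarrow> u + v \<in> mods k"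
  by (auto simp: mods_def intro: vars_in_add)

lemma mods_mono: "u \<in> mods k \<Longrightarrow> u \<in> mods (Suc k)"
  by (auto simp: mods_def intro: vars_in_mono[where V = "{..k}"])

text \<open>As a polynomial in \<open>x_{k+1}\<close> the operator is monic of degree 1, hence
  division with remainder works, by induction on the degree in that variable.\<close>

lemma endo_division_aux:
  assumes "Suc k < m" "u \<in> mods (Suc k)" "\<And>j. exp_le (Suc k) N (u j)"
  shows "\<exists>q\<in>mods (Suc k). \<exists>r\<in>mods k. u = endo (Suc k) q + r"
  using assms(2,3)
proof (induction N arbitrary: u)
  case 0
  then have "u \<in> mods k" by (simp add: mods_def vars_in_Suc_iff[of k])
  moreover have "(0 :: nat \<Rightarrow> (nat, 'a) mpoly) \<in> mods (Suc k)" by (simp add: mods_def)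
  moreover have "u = endo (Suc k) 0 + u"
    by (simp add: fun_eq_iff endo_def shifted_def)
  ultimately show ?case by blast
next
  case (Suc N)
  have "\<exists>g h. u j = g + Var (Suc k) * h \<and> vars_in {..k} g \<and> vars_in {..Suc k} h \<and> exp_le (Suc k) N h" for j
    using Suc.prems by (intro split_off_Var) (auto simp: mods_def)
  then obtain g h where gh: "\<And>j. u j = g j + Var (Suc k) * h j" "\<And>j. vars_in {..k} (g j)"
    "\<And>j. vars_in {..Suc k} (h j)" "\<And>j. exp_le (Suc k) N (h j)"
    by metis
  define g' h' where "g' j = (if j < m then g j else 0)" and "h' j = (if j < m then h j else 0)" for j
  have u: "u j = g' j + Var (Suc k) * h' j" for j
    using gh(1)[of j] Suc.prems(1) by (auto simp: g'_def h'_def mods_def)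
  have g': "g' \<in> mods k" and h': "h' \<in> mods (Suc k)" and h'le: "\<And>j. exp_le (Suc k) N (h' j)"
    using gh by (auto simp: mods_def g'_def h'_def exp_le_def)
  from Suc.IH[OF h' h'le] obtain q r where qr: "q \<in> mods (Suc k)" "r \<in> mods k" "h' = endo (Suc k) q + r"
    by blast
  \<comment> \<open>$x h' = (x - \phi)(xq + r) + \phi r$ when $h' = (x - \phi) q + r$\<close>
  define q' where "q' j = Var (Suc k) * q j + r j" for j
  define r' where "r' = g' + shifted (Suc k) r"
  have "q' \<in> mods (Suc k)"
    using qr(1) mods_mono[OF qr(2)] by (auto simp: mods_def q'_def intro!: vars_in_add vars_in_mult vars_in_Var)
  moreover have "r' \<in> mods k"
    unfolding r'_def using qr(2)
    by (intro mods_add g') (auto simp: mods_def intro: vars_in_shifted, simp add: shifted_def)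
  moreover have "u = endo (Suc k) q' + r'"
  proof
    fix j
    show "u j = (endo (Suc k) q' + r') j"
      by (simp add: u qr(3) r'_def q'_def endo_def shifted_def algebra_simps)
  qed
  ultimately show ?case by blast
qed

lemma mods_exp_le:
  assumes "u \<in> mods l"
  shows "\<exists>N. \<forall>j. exp_le k N (u j)"
proof -
  have "\<forall>j. \<exists>N. exp_le k N (u j)"
    using exists_exp_le by blast
  from choice[OF this] obtain N where N: "\<forall>j. exp_le k (N j) (u j)" ..
  have "exp_le k (Max (N ` {..<m})) (u j)" for j
  proof (cases "j < m")
    case True
    then have "N j \<le> Max (N ` {..<m})" by (intro Max_ge) auto
    then show ?thesis using N unfolding exp_le_def by (meson le_trans)
  next
    case False
    then show ?thesis using assms by (simp add: mods_def exp_le_def)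
  qed
  then show ?thesis by blast
qed

lemma endo_division:
  assumes "Suc k < m" "u \<in> mods (Suc k)"
  shows "\<exists>q\<in>mods (Suc k). \<exists>r\<in>mods k. u = endo (Suc k) q + r"
proof -
  obtain N where N: "\<And>j. exp_le (Suc k) N (u j)"
    using mods_exp_le[OF assms(2)] by blast
  from endo_division_aux[OF assms N] show ?thesis .
qed

text \<open>Multiplication by \<open>x_{k+1}\<close> raises the top degree in that variable, while
  \<open>shifted\<close> only permutes coordinates and multiplies by powers of \<open>y\<close>. A
  leading term therefore survives in the image, which then cannot be free of
  \<open>x_{k+1}\<close>.\<close>

lemma endo_cancel:
  assumes "Suc k < m" and u: "u \<in> mods (Suc k)" and lower: "endo (Suc k) u \<in> mods k"
  shows "u = 0"
proof (rule ccontr)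
  assume "u \<noteq> 0"
  then obtain j0 where "u j0 \<noteq> 0" by (auto simp: fun_eq_iff)
  then obtain mu0 where mu0: "mu0 \<in> Poly_Mapping.keys (u j0)"
    using keys_eq_empty by blast
  define P where "P n \<longleftrightarrow> (\<exists>j mu. mu \<in> Poly_Mapping.keys (u j) \<and> Poly_Mapping.lookup mu (Suc k) = n)" for n
  obtain N where N: "\<And>j. exp_le (Suc k) N (u j)"
    using mods_exp_le[OF u] by blast
  have bound: "n \<le> N" if "P n" for n
    using that N by (auto simp: P_def exp_le_def)
  define n where "n = Greatest P"
  have "P n" unfolding n_def
    using bound mu0 by (intro GreatestI_nat[of P "Poly_Mapping.lookup mu0 (Suc k)"]) (auto simp: P_def)
  then obtain j mu where mu: "mu \<in> Poly_Mapping.keys (u j)" "Poly_Mapping.lookup mu (Suc k) = n"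
    by (auto simp: P_def)
  have max: "Poly_Mapping.lookup nu (Suc k) \<le> n" if "nu \<in> Poly_Mapping.keys (u i)" for nu i
    unfolding n_def using bound that by (intro Greatest_le_nat[of P]) (auto simp: P_def)
  \<comment> \<open>A monomial attaining the maximal degree \<open>n\<close> over all coordinates,
    times \<open>x_{k+1}\<close>; \<open>shifted\<close> has no term of this degree.\<close>
  define e where "e = Poly_Mapping.single (Suc k) 1 + mu"
  have e: "Poly_Mapping.lookup e (Suc k) = Suc n"
    using mu by (simp add: e_def lookup_add)
  have "e \<notin> Poly_Mapping.keys (shifted (Suc k) u j)"
  proof
    assume "e \<in> Poly_Mapping.keys (shifted (Suc k) u j)"
    then obtain a b where ab: "e = a + b" "b \<in> Poly_Mapping.keys (u (sigma (Suc k) j))"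
        "a \<in> Poly_Mapping.keys (Var 0 ^ beta (Suc k) (sigma (Suc k) j) :: (nat, 'a) mpoly)"
      using keys_mult by (fastforce simp: shifted_def split: if_splits)
    then have "Poly_Mapping.lookup a (Suc k) = 0"
      by (simp add: Var_power lookup_single split: if_splits)
    then show False using ab(1) max[OF ab(2)] e by (simp add: lookup_add)
  qed
  then have "Poly_Mapping.lookup (endo (Suc k) u j) e = Poly_Mapping.lookup (u j) mu"
    using lookup_Var_mult_add[of "Suc k" "u j" mu]
    unfolding e_def by (simp add: endo_def lookup_minus in_keys_iff)
  then have "e \<in> Poly_Mapping.keys (endo (Suc k) u j)"
    using mu by (simp add: in_keys_iff)
  moreover have "exp_le (Suc k) 0 (endo (Suc k) u j)"
    using lower vars_in_Suc_iff by (auto simp: mods_def)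
  ultimately show False using e by (auto simp: exp_le_def)
qed

sublocale koszul: koszul_filtration
  "endo :: nat \<Rightarrow> (nat \<Rightarrow> (nat, 'k::field) mpoly) \<Rightarrow> nat \<Rightarrow> (nat, 'k) mpoly" "m - 1" mods aug
proof unfold_locales
  fix i j :: nat and a :: "nat \<Rightarrow> (nat, 'k) mpoly"
  assume "i \<in> {1..m - 1}" "j \<in> {1..m - 1}"
  then show "endo i (endo j a) = endo j (endo i a)"
    using m_pos by (intro endo_commute) auto
next
  fix k a assume "Suc k \<le> m - 1" "a \<in> (mods (Suc k) :: (nat \<Rightarrow> (nat, 'k) mpoly) set)"
  then show "\<exists>q\<in>mods (Suc k). \<exists>r\<in>mods k. a = endo (Suc k) q + r"
    by (intro endo_division) auto
next
  fix k a assume "Suc k \<le> m - 1" "a \<in> (mods (Suc k) :: (nat \<Rightarrow> (nat, 'k) mpoly) set)"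
    "endo (Suc k) a \<in> mods k"
  then show "a = 0"
    by (intro endo_cancel) auto
next
  fix i and a :: "nat \<Rightarrow> (nat, 'k) mpoly" assume "i \<in> {1..m - 1}"
  then show "aug (endo i a) = 0" using m_pos by (intro aug_endo) auto
next
  fix k and a :: "nat \<Rightarrow> (nat, 'k) mpoly" assume "a \<in> mods k"
  then show "- a \<in> mods k" by (auto simp: mods_def intro: vars_in_uminus)
qed (auto simp: endo_add mods_add mods_mono aug_inj aug_def toric_simps algebra_simps sum.distrib
    intro: endo_mods, auto simp: mods_def)

end

subsection \<open>The Koszul resolution of the Apery ring\<close>

lemma sum_fun_apply: "(\<Sum>x\<in>A. f x) j = (\<Sum>x\<in>A. f x j)"
  by (induction A rule: infinite_finite_induct) auto

lemma alt_fun_apply: "alt n f j = alt n (f j)"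
  by (simp add: alt_def)

lemma alt_mult: "alt n (a * b) = alt n a * (b :: 'r::comm_ring_1)"
  by (simp add: alt_def)

text \<open>The index (T, j) stands for $e_T \otimes x_j$, where $x_0$ is to be read as $1$.\<close>

definition kos_index :: "nat \<Rightarrow> nat \<Rightarrow> (nat set \<times> nat) set" where
  "kos_index m d = {T. T \<subseteq> {1..m - 1} \<and> card T = d} \<times> {..<m}"

lemma finite_kos_index: "finite (kos_index m d)"
proof -
  have "finite {T. T \<subseteq> {1..m - 1} \<and> card T = d}"
    by (rule finite_subset[of _ "Pow {1..m - 1}"]) auto
  then show ?thesis by (simp add: kos_index_def)
qed

lemma kos_index_empty:
  assumes "m \<le> d" "m > 0"
  shows "kos_index m d = {}"
proof -
  have "card T \<noteq> d" if "T \<subseteq> {1..m - 1}" for T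
    using card_mono[OF _ that] assms by simp
  then show ?thesis by (simp add: kos_index_def)
qed

text \<open>Stated over any ring, so that the formal matrix and its specialization are instances of
  one formula. At most one \<open>i\<close> contributes to the sum, namely the element of
  \<open>fst q\<close> missing from \<open>fst p\<close>.\<close>

definition kos_mat ::
  "nat \<Rightarrow> (nat \<Rightarrow> 'r::comm_ring_1) \<Rightarrow> (nat \<Rightarrow> nat \<Rightarrow> 'r) \<Rightarrow> nat set \<times> nat \<Rightarrow> nat set \<times> nat \<Rightarrow> 'r" where
  "kos_mat m x y p q = (\<Sum>i\<in>{1..m - 1} - fst p. if fst q = insert i (fst p)
     then alt (card (fst p \<inter> {..<i}))
       ((if snd q = snd p then x i else 0) - (if (i + snd q) mod m = snd p then y i (snd q) else 0))
     else 0)"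

text \<open>For \<open>j = 0\<close> the product with 1 needs no power of \<open>y\<close>; the
  resulting units make the complex non-minimal for \<open>m \<ge> 2\<close>.\<close>

definition kos_formal :: "nat \<Rightarrow> nat set \<times> nat \<Rightarrow> nat set \<times> nat \<Rightarrow> (sym, 'k::field) mpoly" where
  "kos_formal m = kos_mat m (\<lambda>i. Var (X i)) (\<lambda>i j. if j = 0 then 1 else Var (Y i j))"

lemma formal_ok_kos_formal:
  assumes "snd q < m"
  shows "formal_ok m (kos_formal m p q)"
  unfolding formal_ok_iff_vars_in kos_formal_def kos_mat_def using assms
  by (intro vars_in_sum)
     (auto simp: alt_def sym_ok_def intro!: vars_in_diff vars_in_uminus vars_in_Var)

lemma specialize_simps:
  "specialize S 0 = 0" "specialize S 1 = 1" "specialize S (f + g) = specialize S f + specialize S g"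
  "specialize S (f - g) = specialize S f - specialize S g" "specialize S (- f) = - specialize S f"
  "specialize S (f * g) = specialize S f * specialize S g"
  "specialize S (Poly_Mapping.single 0 c) = Poly_Mapping.single 0 c"
  "specialize S (Var v) = sym_val S v"
  by (simp_all add: specialize_def const_hom.subst_add const_hom.subst_diff
      const_hom.subst_uminus const_hom.subst_mult const_hom.subst_Var const_hom.subst_single)

lemma specialize_sum: "specialize S (\<Sum>x\<in>A. f x) = (\<Sum>x\<in>A. specialize S (f x))"
  by (simp add: specialize_def const_hom.subst_sum)

lemma specialize_kos_mat:
  fixes x :: "nat \<Rightarrow> (sym, 'k::field) mpoly"
  shows "specialize S (kos_mat m x y p q) = kos_mat m (\<lambda>i. specialize S (x i)) (\<lambda>i j. specialize S (y i j)) p q"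
proof -
  have "specialize S (alt n f) = alt n (specialize S f)" for n and f :: "(sym, 'k) mpoly"
    by (simp add: alt_def specialize_simps)
  then show ?thesis
    unfolding kos_mat_def specialize_sum
    by (intro sum.cong refl) (simp add: specialize_simps)
qed

text \<open>Taking constant terms commutes with substitution, so only the constant terms of the
  values of the symbols matter.\<close>

lemma cterm_specialize_cong:
  assumes "formal_ok m f" and "\<And>v. sym_ok m v \<Longrightarrow> cterm (sym_val S v :: (nat, 'k::field) mpoly) = cterm (sym_val S' v :: (nat, 'k) mpoly)"
  shows "cterm (specialize S f :: (nat, 'k) mpoly) = cterm (specialize S' f)"
proof -
  have "cterm (monom_val (sym_val S) mu :: (nat, 'k) mpoly) = cterm (monom_val (sym_val S') mu :: (nat, 'k) mpoly)"
    if "mu \<in> Poly_Mapping.keys f" for mu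
    unfolding monom_val_def cterm_prod cterm_power
    using assms that by (intro prod.cong refl) (auto simp: formal_ok_def)
  then show ?thesis
    unfolding specialize_def subst_monom_val cterm_sum cterm_mult
    by (intro sum.cong refl) simp
qed

section \<open>The weighted grading\<close>

lemma homogeneous_0 [simp]: "homogeneous S d 0"
  by (simp add: homogeneous_def)

lemma homogeneous_add: "homogeneous S d f \<Longrightarrow> homogeneous S d g \<Longrightarrow> homogeneous S d (f + g)"
  using keys_add[of f g] by (auto simp: homogeneous_def)

lemma homogeneous_uminus:
  fixes f :: "(nat, 'k::comm_ring_1) mpoly"
  shows "homogeneous S d f \<Longrightarrow> homogeneous S d (- f)"
  by (auto simp: homogeneous_def in_keys_iff)

lemma homogeneous_diff:
  fixes f :: "(nat, 'k::comm_ring_1) mpoly"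
  shows "homogeneous S d f \<Longrightarrow> homogeneous S d g \<Longrightarrow> homogeneous S d (f - g)"
  using homogeneous_add[of S d f "- g"] homogeneous_uminus[of S d g] by simp

lemma homogeneous_sum:
  fixes f :: "'a \<Rightarrow> (nat, 'k::comm_ring_1) mpoly"
  shows "(\<And>x. x \<in> A \<Longrightarrow> homogeneous S d (f x)) \<Longrightarrow> homogeneous S d (\<Sum>x\<in>A. f x)"
  by (induction A rule: infinite_finite_induct) (auto intro: homogeneous_add)

lemma wdeg_superset:
  assumes "finite A" "Poly_Mapping.keys mu \<subseteq> A"
  shows "wdeg S mu = (\<Sum>v\<in>A. Poly_Mapping.lookup mu v * apery S v)"
  unfolding wdeg_def using assms
  by (intro sum.mono_neutral_left) (auto simp: in_keys_iff)

lemma wdeg_add: "wdeg S (mu + nu) = wdeg S mu + wdeg S nu"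
proof -
  let ?A = "Poly_Mapping.keys mu \<union> Poly_Mapping.keys nu"
  have "wdeg S (mu + nu) = (\<Sum>v\<in>?A. Poly_Mapping.lookup (mu + nu) v * apery S v)"
    using keys_add[of mu nu] by (intro wdeg_superset) auto
  also have "\<dots> = wdeg S mu + wdeg S nu"
    by (subst (1 2) wdeg_superset[of ?A]) (auto simp: lookup_add algebra_simps sum.distrib)
  finally show ?thesis .
qed

lemma homogeneous_mult:
  fixes f g :: "(nat, 'k::comm_ring_1) mpoly"
  assumes "homogeneous S d f" "homogeneous S e g"
  shows "homogeneous S (d + e) (f * g)"
  unfolding homogeneous_def
proof
  fix mu assume "mu \<in> Poly_Mapping.keys (f * g)"
  then obtain a b where "mu = a + b" "a \<in> Poly_Mapping.keys f" "b \<in> Poly_Mapping.keys g"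
    using keys_mult[of f g] by auto
  then show "int (wdeg S mu) = d + e"
    using assms by (auto simp: homogeneous_def wdeg_add)
qed

lemma homogeneous_const: "homogeneous S 0 (Poly_Mapping.single 0 c)"
  by (simp add: homogeneous_def wdeg_def)

lemma homogeneous_Var_power:
  "homogeneous S (int (n * apery S v)) (Var v ^ n :: (nat, 'k::comm_ring_1) mpoly)"
  by (cases "n = 0") (auto simp: Var_power homogeneous_def wdeg_def)

lemma homogeneous_Var: "homogeneous S (int (apery S v)) (Var v :: (nat, 'k::comm_ring_1) mpoly)"
  using homogeneous_Var_power[of S 1 v] by simp

interpretation inR: subring "Collect (inR m) :: (nat, 'k::field) mpoly set" for m
  by unfold_locales (auto simp: inR_iff_vars_in intro: vars_in_add vars_in_mult vars_in_uminus)

context mult_semigroup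
begin

abbreviation kos_diff :: "nat set \<times> nat \<Rightarrow> nat set \<times> nat \<Rightarrow> (nat, 'k::field) mpoly" where
  "kos_diff \<equiv> kos_mat m Var (\<lambda>i j. Var 0 ^ beta i j)"

lemma specialize_kos_formal: "specialize S (kos_formal m p q :: (sym, 'k::field) mpoly) = kos_diff p q"
proof -
  have "(\<lambda>i j. specialize S (if j = 0 then 1 else Var (Y i j) :: (sym, 'k) mpoly)) = (\<lambda>i j. Var 0 ^ beta i j)"
    by (auto simp: fun_eq_iff specialize_simps beta_def sym_val_def)
  moreover have "(\<lambda>i. specialize S (Var (X i) :: (sym, 'k) mpoly)) = Var"
    by (auto simp: fun_eq_iff specialize_simps sym_val_def)
  ultimately show ?thesis by (simp add: kos_formal_def specialize_kos_mat)
qed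

lemma shifted_sum:
  assumes "i < m" "j < m"
  shows "shifted i u j = (\<Sum>k<m. if (i + k) mod m = j then Var 0 ^ beta i k * u k else 0)"
proof -
  have "(i + k) mod m = j \<longleftrightarrow> k = sigma i j" if "k < m" for k
    using sigma_add[OF assms(1) that] add_sigma[OF assms] by auto
  then have "(\<Sum>k<m. if (i + k) mod m = j then Var 0 ^ beta i k * u k else 0)
    = (\<Sum>k<m. if k = sigma i j then Var 0 ^ beta i k * u k else 0)"
    by (intro sum.cong) auto
  then show ?thesis
    using assms sigma_less by (simp add: shifted_def)
qed

text \<open>Dictionary between vectors indexed by pairs \<open>(T, j)\<close> and chains of
  coordinate families. Only components of cardinality \<open>d + 1\<close> enter the differential at
  \<open>T\<close>, so \<open>v\<close> is arbitrary elsewhere.\<close>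

lemma kos_diff_koszul:
  assumes T: "T \<subseteq> {1..m - 1}" "card T = d" "j < m"
    and v: "\<And>T' k. (T', k) \<in> kos_index m (Suc d) \<Longrightarrow> v T' k = u (T', k)"
  shows "(\<Sum>q\<in>kos_index m (Suc d). kos_diff (T, j) q * u q) = koszul endo (m - 1) v T j"
proof -
  let ?J = "{T. T \<subseteq> {1..m - 1} \<and> card T = Suc d}"
  let ?c = "\<lambda>i. card (T \<inter> {..<i})"
  let ?e = "\<lambda>i k. (if k = j then Var i else 0) - (if (i + k) mod m = j then Var 0 ^ beta i k else 0)"
  have finT: "finite T" using T(1) by (rule finite_subset) simp
  have finJ: "finite ?J" by (rule finite_subset[of _ "Pow {1..m - 1}"]) auto
  have "(\<Sum>q\<in>kos_index m (Suc d). kos_diff (T, j) q * u q)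
    = (\<Sum>q\<in>kos_index m (Suc d). \<Sum>i\<in>{1..m - 1} - T. if fst q = insert i T then alt (?c i) (?e i (snd q) * u q) else 0)"
    unfolding kos_mat_def sum_distrib_right
    by (intro sum.cong refl) (auto simp: alt_mult)
  also have "\<dots> = (\<Sum>i\<in>{1..m - 1} - T. \<Sum>q\<in>kos_index m (Suc d). if fst q = insert i T then alt (?c i) (?e i (snd q) * u q) else 0)"
    by (rule sum.swap)
  also have "\<dots> = (\<Sum>i\<in>{1..m - 1} - T. alt (?c i) (endo i (v (insert i T)) j))"
  proof (intro sum.cong refl)
    fix i assume i: "i \<in> {1..m - 1} - T"
    then have im: "i < m" by auto
    have ins: "insert i T \<in> ?J" using i T finT by auto
    have "(\<Sum>q\<in>kos_index m (Suc d). if fst q = insert i T then alt (?c i) (?e i (snd q) * u q) else 0)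
      = (\<Sum>T'\<in>?J. \<Sum>k<m. if T' = insert i T then alt (?c i) (?e i k * u (T', k)) else 0)"
      unfolding kos_index_def by (subst sum.cartesian_product) (simp only: split_def fst_conv snd_conv prod.collapse)
    also have "\<dots> = (\<Sum>T'\<in>?J. if T' = insert i T then (\<Sum>k<m. alt (?c i) (?e i k * u (T', k))) else 0)"
      by (rule sum.cong[OF refl]) simp
    also have "\<dots> = (\<Sum>k<m. alt (?c i) (?e i k * u (insert i T, k)))"
      by (simp only: sum.delta[OF finJ] ins if_True)
    also have "\<dots> = alt (?c i) (\<Sum>k<m. ?e i k * v (insert i T) k)"
      unfolding alt_sum
    proof (rule sum.cong[OF refl])
      fix k assume "k \<in> {..<m}"
      then have "(insert i T, k) \<in> kos_index m (Suc d)"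
        using ins by (simp add: kos_index_def)
      then show "alt (?c i) (?e i k * u (insert i T, k)) = alt (?c i) (?e i k * v (insert i T) k)"
        by (simp only: v)
    qed
    also have "(\<Sum>k<m. ?e i k * v (insert i T) k)
      = (\<Sum>k<m. if k = j then Var i * v (insert i T) k else 0)
        - (\<Sum>k<m. if (i + k) mod m = j then Var 0 ^ beta i k * v (insert i T) k else 0)"
      unfolding sum_subtractf[symmetric] by (rule sum.cong[OF refl]) (simp add: left_diff_distrib)
    also have "\<dots> = endo i (v (insert i T)) j"
      using T by (simp add: endo_def shifted_sum[OF im T(3)])
    finally show "(\<Sum>q\<in>kos_index m (Suc d). if fst q = insert i T then alt (?c i) (?e i (snd q) * u q) else 0)
      = alt (?c i) (endo i (v (insert i T)) j)" .
  qed
  also have "\<dots> = koszul endo (m - 1) v T j"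
    by (simp add: koszul_def sum_fun_apply alt_fun_apply)
  finally show ?thesis .
qed

text \<open>Views a vector of homological degree \<open>d\<close> as a chain in all degrees, the
  form that \<open>koszul_exact\<close> expects.\<close>

definition extend :: "nat \<Rightarrow> (nat set \<times> nat \<Rightarrow> (nat, 'k::field) mpoly) \<Rightarrow> nat set \<Rightarrow> nat \<Rightarrow> (nat, 'k) mpoly" where
  "extend d u T j = (if (T, j) \<in> kos_index m d then u (T, j) else 0)"

lemma atMost_pred_m: "{..m - 1} = {..<m}" "{..m - Suc 0} = {..<m}"
  using m_pos by auto

lemma extend_mods:
  assumes "\<forall>p\<in>kos_index m d. inR m (u p)"
  shows "extend d u T \<in> mods (m - 1)"
  using assms unfolding mods_def atMost_pred_m
  by (auto simp: extend_def inR_iff_vars_in) (auto simp: kos_index_def)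

lemma koszul_extend_other:
  assumes "T \<subseteq> {1..m - 1}" "Suc (card T) \<noteq> d"
  shows "koszul endo (m - 1) (extend d u) T = 0"
  unfolding koszul_def
proof (intro sum.neutral ballI)
  fix i assume i: "i \<in> {1..m - 1} - T"
  have "finite T" using assms(1) by (rule finite_subset) simp
  then have "extend d u (insert i T) = 0"
    using assms(2) i by (auto simp: fun_eq_iff extend_def kos_index_def)
  then show "alt (card (T \<inter> {..<i})) (endo i (extend d u (insert i T))) = 0"
    using i by (simp add: koszul.f_0)
qed

lemma koszul_cycle_boundary:
  assumes u: "\<forall>p\<in>kos_index m d. inR m (u p)"
    and cycle: "\<And>T. T \<subseteq> {1..m - 1} \<Longrightarrow> koszul endo (m - 1) (extend d u) T = 0"
    and aug: "aug (extend d u {}) = 0"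
  shows "\<exists>w. (\<forall>q\<in>kos_index m (Suc d). inR m (w q)) \<and>
    (\<forall>p\<in>kos_index m d. u p = (\<Sum>q\<in>kos_index m (Suc d). kos_diff p q * w q))"
proof -
  obtain w where w: "\<forall>T. w T \<in> mods (m - 1)"
    "\<forall>T. T \<subseteq> {1..m - 1} \<longrightarrow> extend d u T = koszul endo (m - 1) w T"
    using koszul.koszul_exact[of "m - 1" "extend d u", OF _ extend_mods[OF u] cycle aug] by auto
  have "u p = (\<Sum>q\<in>kos_index m (Suc d). kos_diff p q * (\<lambda>(T, k). w T k) q)" if p: "p \<in> kos_index m d" for p
  proof -
    obtain T j where Tj: "p = (T, j)" "T \<subseteq> {1..m - 1}" "card T = d" "j < m"
      using p by (auto simp: kos_index_def)
    have "u p = extend d u T j" using p Tj by (simp add: extend_def)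
    also have "\<dots> = koszul endo (m - 1) w T j" using w Tj by simp
    finally show ?thesis
      using kos_diff_koszul[OF Tj(2-4), of w "\<lambda>(T, k). w T k"] Tj(1) by simp
  qed
  moreover have "\<forall>q\<in>kos_index m (Suc d). inR m ((\<lambda>(T, k). w T k) q)"
    using w(1) by (auto simp: mods_def inR_iff_vars_in atMost_pred_m)
  ultimately show ?thesis by blast
qed

lemma kos_diff_extend:
  assumes "(T, j) \<in> kos_index m d"
  shows "(\<Sum>q\<in>kos_index m (Suc d). kos_diff (T, j) q * u q) = koszul endo (m - 1) (extend (Suc d) u) T j"
  using assms by (intro kos_diff_koszul) (auto simp: extend_def kos_index_def)

lemma kos_resolution:
  "inR.resolution m (toric S :: (nat, 'k::field) mpoly \<Rightarrow> 'k poly) (\<lambda>(T, j). monom 1 (s j)) (kos_index m) (\<lambda>d. kos_diff)"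
  unfolding inR.resolution_def
proof (intro conjI allI ballI)
  show "finite (kos_index m d)" for d by (rule finite_kos_index)
next
  fix d p q assume "p \<in> kos_index m d" "q \<in> kos_index m (Suc d)"
  show "(kos_diff p q :: (nat, 'k) mpoly) \<in> Collect (inR m)"
    unfolding kos_mat_def using m_pos
    by (auto intro!: vars_in_sum vars_in_diff vars_in_Var vars_in_power vars_in_uminus simp: inR_iff_vars_in alt_def)
next
  have aug_eq: "(\<Sum>k\<in>kos_index m 0. (case k of (T, j) \<Rightarrow> monom 1 (s j)) * toric S (u k)) = aug (v {})"
    if v: "\<And>j. j < m \<Longrightarrow> v {} j = u ({}, j)"
    for u and v :: "nat set \<Rightarrow> nat \<Rightarrow> (nat, 'k) mpoly"
  proof -
    have "{T. T \<subseteq> {1..m - 1} \<and> card T = 0} = {{}}"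
      using finite_subset[of _ "{1..m - 1}"] by auto
    then have "kos_index m 0 = Pair {} ` {..<m}"
      by (auto simp: kos_index_def)
    then show ?thesis
      using v by (simp add: sum.reindex inj_on_def aug_def)
  qed
  show "exact_at (Collect (inR m)) (\<lambda>u. (\<Sum>k\<in>kos_index m 0. (case k of (T, j) \<Rightarrow> monom 1 (s j)) * toric S (u k :: (nat, 'k) mpoly)) = 0)
     (kos_index m 0) kos_diff (kos_index m 1)"
    unfolding exact_at_def mem_Collect_eq
  proof (intro allI impI iffI)
    fix u :: "nat set \<times> nat \<Rightarrow> (nat, 'k) mpoly"
    assume u: "\<forall>j\<in>kos_index m 0. inR m (u j)"
      and 0: "(\<Sum>k\<in>kos_index m 0. (case k of (T, j) \<Rightarrow> monom 1 (s j)) * toric S (u k)) = 0"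
    have "aug (extend 0 u {}) = 0"
      using 0 by (subst (asm) aug_eq[of "extend 0 u"]) (auto simp: extend_def kos_index_def)
    then show "\<exists>w. (\<forall>l\<in>kos_index m 1. inR m (w l)) \<and>
        (\<forall>j\<in>kos_index m 0. u j = (\<Sum>l\<in>kos_index m 1. kos_diff j l * w l))"
      using koszul_cycle_boundary[OF u koszul_extend_other] by simp
  next
    fix u :: "nat set \<times> nat \<Rightarrow> (nat, 'k) mpoly"
    assume "\<exists>w. (\<forall>l\<in>kos_index m 1. inR m (w l)) \<and>
        (\<forall>j\<in>kos_index m 0. u j = (\<Sum>l\<in>kos_index m 1. kos_diff j l * w l))"
    then obtain w where "\<forall>j\<in>kos_index m 0. u j = (\<Sum>l\<in>kos_index m 1. kos_diff j l * w l)" by blast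
    then have "koszul endo (m - 1) (extend 1 w) {} j = u ({}, j)" if "j < m" for j
      using kos_diff_extend[of "{}" j 0 w] that by (simp add: kos_index_def)
    then show "(\<Sum>k\<in>kos_index m 0. (case k of (T, j) \<Rightarrow> monom 1 (s j)) * toric S (u k)) = 0"
      by (subst aug_eq[of "koszul endo (m - 1) (extend 1 w)"]) (auto simp: koszul.aug_koszul)
  qed
next
  fix d
  show "exact_at (Collect (inR m)) (in_ker (kos_index m d) (kos_diff :: _ \<Rightarrow> _ \<Rightarrow> (nat, 'k) mpoly) (kos_index m (Suc d)))
     (kos_index m (Suc d)) kos_diff (kos_index m (Suc (Suc d)))"
    unfolding exact_at_def mem_Collect_eq
  proof (intro allI impI iffI)
    fix u :: "nat set \<times> nat \<Rightarrow> (nat, 'k) mpoly"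
    assume u: "\<forall>j\<in>kos_index m (Suc d). inR m (u j)"
      and ker: "in_ker (kos_index m d) kos_diff (kos_index m (Suc d)) u"
    have cycle: "koszul endo (m - 1) (extend (Suc d) u) T = 0" if T: "T \<subseteq> {1..m - 1}" for T
    proof (cases "card T = d")
      case True
      show ?thesis
      proof
        fix j
        show "koszul endo (m - 1) (extend (Suc d) u) T j = 0 j"
        proof (cases "j < m")
          case True
          then have "(T, j) \<in> kos_index m d" using T \<open>card T = d\<close> by (simp add: kos_index_def)
          then show ?thesis
            using ker kos_diff_extend[of T j d u] by (simp add: in_ker_def)
        next
          case False
          \<comment> \<open>The kernel condition says nothing about coordinates from
            \<open>m\<close> on; these vanish for every element of \<open>mods\<close>.\<close>
          have "koszul endo (m - 1) (extend (Suc d) u) T \<in> mods (m - 1)"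
            using T extend_mods[OF u] by (intro koszul.M_koszul) auto
          then show ?thesis using False by (simp add: mods_def)
        qed
      qed
    next
      case False
      then show ?thesis using T by (intro koszul_extend_other) simp_all
    qed
    have "extend (Suc d) u {} = 0" by (simp add: fun_eq_iff extend_def kos_index_def)
    then have "aug (extend (Suc d) u {}) = 0" by (simp add: koszul.aug_0)
    from koszul_cycle_boundary[OF u cycle this]
    show "\<exists>w. (\<forall>l\<in>kos_index m (Suc (Suc d)). inR m (w l)) \<and>
        (\<forall>j\<in>kos_index m (Suc d). u j = (\<Sum>l\<in>kos_index m (Suc (Suc d)). kos_diff j l * w l))" .
  next
    fix u :: "nat set \<times> nat \<Rightarrow> (nat, 'k) mpoly"
    assume "\<exists>w. (\<forall>l\<in>kos_index m (Suc (Suc d)). inR m (w l)) \<and>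
        (\<forall>j\<in>kos_index m (Suc d). u j = (\<Sum>l\<in>kos_index m (Suc (Suc d)). kos_diff j l * w l))"
    then obtain w where w: "\<forall>j\<in>kos_index m (Suc d). u j = (\<Sum>l\<in>kos_index m (Suc (Suc d)). kos_diff j l * w l)"
      by blast
    let ?w = "koszul endo (m - 1) (extend (Suc (Suc d)) w)"
    have eq: "?w T k = u (T, k)" if "(T, k) \<in> kos_index m (Suc d)" for T k
      using w that kos_diff_extend[OF that, of w] by simp
    show "in_ker (kos_index m d) kos_diff (kos_index m (Suc d)) u"
      unfolding in_ker_def
    proof
      fix p assume "p \<in> kos_index m d"
      then obtain T j where p: "p = (T, j)" "T \<subseteq> {1..m - 1}" "card T = d" "j < m"
        by (auto simp: kos_index_def)
      have "(\<Sum>q\<in>kos_index m (Suc d). kos_diff (T, j) q * u q) = koszul endo (m - 1) ?w T j"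
        using eq by (intro kos_diff_koszul p)
      then show "(\<Sum>q\<in>kos_index m (Suc d). kos_diff p q * u q) = 0"
        by (simp add: p(1) koszul.koszul_koszul)
    qed
  qed
qed

text \<open>The degree of \<open>e_T \<otimes> x_j\<close>: each \<open>e_i\<close> has degree
  \<open>a_i\<close>, which makes the Koszul differential homogeneous of degree 0.\<close>

definition shift :: "nat set \<times> nat \<Rightarrow> int" where
  "shift p = int ((\<Sum>i\<in>fst p. apery S i) + s (snd p))"

lemma homogeneous_kos_diff:
  assumes p: "p \<in> kos_index m d" and q: "q \<in> kos_index m e"
  shows "homogeneous S (shift q - shift p) (kos_diff p q :: (nat, 'k::field) mpoly)"
  unfolding kos_mat_def
proof (intro homogeneous_sum)
  fix i assume i: "i \<in> {1..m - 1} - fst p"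
  let ?D = "shift q - shift p"
  have fin: "finite (fst p)" using p finite_subset[of "fst p" "{1..m - 1}"] by (auto simp: kos_index_def)
  have im: "1 \<le> i" "i < m" "snd q < m" using i m_pos q by (auto simp: kos_index_def)
  have D: "?D = int (apery S i) + int (s (snd q)) - int (s (snd p))" if "fst q = insert i (fst p)"
    using that i fin by (simp add: shift_def)
  have "homogeneous S ?D (Var i :: (nat, 'k) mpoly)" if "fst q = insert i (fst p)" "snd q = snd p"
    using D[OF that(1)] that(2) homogeneous_Var[of S i] by simp
  moreover have "homogeneous S ?D (Var 0 ^ beta i (snd q) :: (nat, 'k) mpoly)"
    if "fst q = insert i (fst p)" "(i + snd q) mod m = snd p"
  proof -
    have "?D = int (beta i (snd q) * apery S 0)"
    proof -
      have "int (apery S i + s (snd q)) = int (beta i (snd q) * apery S 0 + s (snd p))"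
        using beta_apery[OF im] that(2) by (simp add: apery_eq[of 0] mult.commute)
      then show ?thesis using D[OF that(1)] by simp
    qed
    then show ?thesis using homogeneous_Var_power[of S "beta i (snd q)" 0] by simp
  qed
  ultimately show "homogeneous S ?D
     (if fst q = insert i (fst p) then alt (card (fst p \<inter> {..<i}))
       ((if snd q = snd p then Var i else 0) - (if (i + snd q) mod m = snd p then Var 0 ^ beta i (snd q) else 0)) else 0 :: (nat, 'k) mpoly)"
    by (auto simp: alt_def intro!: homogeneous_diff homogeneous_uminus)
qed

text \<open>A constant term forces degree 0, and since all weights are positive the part of degree 0
  consists of constants.\<close>

lemma homogeneous_eq_const:
  assumes "homogeneous S d f" "cterm f \<noteq> 0"
  shows "d = 0" "f = Poly_Mapping.single 0 (cterm f)"
proof -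
  have "0 \<in> Poly_Mapping.keys f" using assms(2) by (simp add: cterm_def in_keys_iff)
  then show d: "d = 0" using assms(1) by (auto simp: homogeneous_def wdeg_def)
  have "Poly_Mapping.lookup f mu = 0" if "mu \<noteq> 0" for mu
  proof (rule ccontr)
    assume "Poly_Mapping.lookup f mu \<noteq> 0"
    then have "mu \<in> Poly_Mapping.keys f" by (simp add: in_keys_iff)
    then show False using assms(1) that by (simp add: homogeneous_def d wdeg_eq_0_iff)
  qed
  then show "f = Poly_Mapping.single 0 (cterm f)"
    by (intro poly_mapping_eqI) (auto simp: cterm_def lookup_single when_def)
qed

end

subsection \<open>Faces of the Kunz cone and uniform minimization\<close>

text \<open>The segment from \<open>w\<close> to \<open>z\<close> can be prolonged beyond
  \<open>z\<close> inside \<open>F\<close>. A linear function that is nonnegative on both ends and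
  zero at the inner point \<open>z\<close> is zero on the ends.\<close>

lemma rel_interior_zero_imp_zero:
  fixes g :: "'a::euclidean_space \<Rightarrow> real"
  assumes "convex F" "linear g" "\<And>x. x \<in> F \<Longrightarrow> 0 \<le> g x" "z \<in> rel_interior F" "g z = 0" "w \<in> F"
  shows "g w = 0"
proof -
  have "F \<noteq> {}" using assms(6) by auto
  then obtain c where c: "c > 1" "(1 - c) *\<^sub>R w + c *\<^sub>R z \<in> F"
    using convex_rel_interior_iff[OF assms(1), of z] assms(4,6) by blast
  then have "0 \<le> (1 - c) * g w"
    using assms(3)[OF c(2)] assms(5) by (simp add: linear_add[OF assms(2)] linear_scale[OF assms(2)])
  then have "g w \<le> 0" using c(1) by (simp add: zero_le_mult_iff)
  then show ?thesis using assms(3)[OF assms(6)] by simp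
qed

lemma apery_vec_nth:
  assumes "inj_on e {1..<m}" "i \<in> {1..<m}"
  shows "apery_vec m e S $ e i = real (apery S i)"
  using assms by (simp add: apery_vec_def the_inv_into_f_f)

text \<open>A vanishing exponent is a tight inequality of the cone. The pairs with
  \<open>i + j = m\<close>, for which the cone has no inequality, always have a positive
  exponent.\<close>

lemma (in mult_semigroup) b_coef_eq_0_iff:
  assumes "inj_on e {1..<m}" "1 \<le> i" "i < m" "1 \<le> j" "j < m"
  shows "b_coef S i j = 0 \<longleftrightarrow> i + j \<noteq> m \<and>
    apery_vec m e S $ e i + apery_vec m e S $ e j - apery_vec m e S $ e ((i + j) mod m) = 0"
proof (cases "i + j = m")
  case True
  then show ?thesis using b_coef_pos[of i j] by simp
next
  case False
  have "(i + j) mod m \<noteq> 0"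
  proof
    assume "(i + j) mod m = 0"
    then obtain k where k: "i + j = m * k" by auto
    then have "m * k < m * 2" "0 < m * k" using assms by linarith+
    then have "k = 1" by (cases k) auto
    then show False using False k by simp
  qed
  moreover have "(i + j) mod m < m" using m_pos by simp
  ultimately have mem: "(i + j) mod m \<in> {1..<m}" by auto
  have "m * b_coef S i j + s ((i + j) mod m) = apery S i + apery S j"
    using beta_apery[of i j] assms by (simp add: beta_def apery_eq[of j])
  moreover have "s ((i + j) mod m) = apery S ((i + j) mod m)"
    using mem by (simp add: apery_eq)
  ultimately have "b_coef S i j = 0 \<longleftrightarrow> apery S i + apery S j = apery S ((i + j) mod m)"
    using m_pos by auto
  also have "\<dots> \<longleftrightarrow> real (apery S i) + real (apery S j) - real (apery S ((i + j) mod m)) = 0"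
    by linarith
  finally show ?thesis
    using False assms mem apery_vec_nth[OF assms(1)] by simp
qed

lemma b_coef_zero_pattern:
  fixes e :: "nat \<Rightarrow> 'n::finite"
  assumes e: "inj_on e {1..<m}" and F: "convex F" "F \<subseteq> kunz_cone m e"
    and S: "mult_semigroup S m" "apery_vec m e S \<in> rel_interior F"
    and S': "mult_semigroup S' m" "apery_vec m e S' \<in> rel_interior F"
    and ij: "1 \<le> i" "i < m" "1 \<le> j" "j < m" and 0: "b_coef S i j = 0"
  shows "b_coef S' i j = 0"
proof -
  \<comment> \<open>The functional of the inequality for \<open>i\<close>, \<open>j\<close>; it is
    nonnegative on the cone and hence on \<open>F\<close>.\<close>
  define g where "g z = z $ e i + z $ e j - z $ e ((i + j) mod m)" for z :: "real ^ 'n"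
  have "linear g" by unfold_locales (auto simp: g_def algebra_simps)
  moreover have ne: "i + j \<noteq> m" and gS: "g (apery_vec m e S) = 0"
    using mult_semigroup.b_coef_eq_0_iff[OF S(1) e ij] 0 by (auto simp: g_def)
  moreover have "0 \<le> g z" if "z \<in> F" for z
  proof -
    have "z \<in> kunz_cone m e" using that F(2) by blast
    then show ?thesis
      using ij ne unfolding kunz_cone_def g_def
      by (cases "i \<le> j") (auto simp: add.commute)
  qed
  moreover have "apery_vec m e S' \<in> F" using S'(2) rel_interior_subset by blast
  ultimately have "g (apery_vec m e S') = 0"
    using rel_interior_zero_imp_zero[OF F(1)] S(2) by blast
  then show ?thesis
    using mult_semigroup.b_coef_eq_0_iff[OF S'(1) e ij] ne by (simp add: g_def)
qed

section \<open>Minimization simultaneously for all semigroups\<close>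

lemma specialize_schur:
  "specialize S (schur A (Poly_Mapping.single 0 c) p q i k)
    = schur (\<lambda>i k. specialize S (A i k)) (Poly_Mapping.single 0 c) p q i k"
  by (simp add: schur_def specialize_simps)

text \<open>The invariant of the cancellation process. Surviving basis elements keep their Koszul
  labels, so the degree shifts are still those of the Koszul complex.\<close>

definition uniform_resolution ::
  "nat \<Rightarrow> nat set set \<Rightarrow> (nat \<Rightarrow> (nat set \<times> nat) set)
    \<Rightarrow> (nat \<Rightarrow> nat set \<times> nat \<Rightarrow> nat set \<times> nat \<Rightarrow> (sym, 'k::field) mpoly) \<Rightarrow> bool" where
  "uniform_resolution m G I N \<longleftrightarrow> (\<forall>d. I d \<subseteq> kos_index m d) \<and> ({}, 0) \<in> I 0 \<and>
     (\<forall>d. \<forall>p\<in>I d. \<forall>q\<in>I (Suc d). formal_ok m (N d p q)) \<and>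
     (\<forall>S\<in>G. inR.resolution m (toric S) (\<lambda>(T, j). monom 1 (mult_semigroup.s S m j)) I (\<lambda>d p q. specialize S (N d p q)) \<and>
       (\<forall>d. \<forall>p\<in>I d. \<forall>q\<in>I (Suc d). homogeneous S (mult_semigroup.shift S m q - mult_semigroup.shift S m p) (specialize S (N d p q))))"

lemma uniform_resolution_kos:
  assumes "\<And>S. S \<in> G \<Longrightarrow> mult_semigroup S m" "m > 0"
  shows "uniform_resolution m G (kos_index m) (\<lambda>d. kos_formal m :: _ \<Rightarrow> _ \<Rightarrow> (sym, 'k::field) mpoly)"
  unfolding uniform_resolution_def
proof (intro conjI allI ballI)
  show "({}, 0) \<in> kos_index m 0" using assms(2) by (simp add: kos_index_def)
next
  fix d p q assume "q \<in> kos_index m (Suc d)"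
  then show "formal_ok m (kos_formal m p q :: (sym, 'k) mpoly)"
    by (intro formal_ok_kos_formal) (auto simp: kos_index_def)
next
  fix S assume "S \<in> G"
  then interpret mult_semigroup S m by (rule assms)
  show "inR.resolution m (toric S) (\<lambda>(T, j). monom 1 (s j)) (kos_index m)
     (\<lambda>d p q. specialize S (kos_formal m p q :: (sym, 'k) mpoly))"
    unfolding specialize_kos_formal by (rule kos_resolution)
next
  fix S d p q assume "S \<in> G" and pq: "p \<in> kos_index m d" "q \<in> kos_index m (Suc d)"
  then interpret mult_semigroup S m by (intro assms)
  show "homogeneous S (shift q - shift p) (specialize S (kos_formal m p q :: (sym, 'k) mpoly))"
    unfolding specialize_kos_formal by (rule homogeneous_kos_diff[OF pq])
qed simp

text \<open>The scalar \<open>1 / c\<close> is an inverse of the pivot only after specialization,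
  where homogeneity turns the pivot into the constant \<open>c\<close>. This is enough, because
  exactness is claimed for the specialized matrices alone.\<close>

lemma uniform_resolution_cancel:
  fixes N :: "nat \<Rightarrow> nat set \<times> nat \<Rightarrow> nat set \<times> nat \<Rightarrow> (sym, 'k::field) mpoly"
  assumes G: "\<And>S. S \<in> G \<Longrightarrow> mult_semigroup S m" and ur: "uniform_resolution m G I N"
    and pq: "p \<in> I d" "q \<in> I (Suc d)" "\<not> (d = 0 \<and> p = ({}, 0))"
    and c: "c \<noteq> 0" "\<And>S. S \<in> G \<Longrightarrow> cterm (specialize S (N d p q)) = c"
  shows "uniform_resolution m G (I(d := I d - {p}, Suc d := I (Suc d) - {q}))
    (N(d := schur (N d) (Poly_Mapping.single 0 (1 / c)) p q))"
    (is "uniform_resolution m G ?I ?N")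
proof -
  let ?c = "Poly_Mapping.single 0 (1 / c)"
  have sub: "?I e \<subseteq> I e" for e by auto
  have fok: "formal_ok m (N e i k)" if "i \<in> I e" "k \<in> I (Suc e)" for e i k
    using ur that by (simp add: uniform_resolution_def)
  have "formal_ok m (?N e i k)" if "i \<in> ?I e" "k \<in> ?I (Suc e)" for e i k
  proof -
    have ik: "i \<in> I e" "k \<in> I (Suc e)" using that sub by blast+
    show ?thesis
    proof (cases "e = d")
      case True
      then show ?thesis
        using fok[OF ik] fok[of i d q] fok[of p d k] ik pq
        unfolding formal_ok_iff_vars_in
        by (auto simp: schur_def intro!: vars_in_diff vars_in_mult)
    qed (use fok[OF ik] in simp)
  qed
  moreover have "inR.resolution m (toric S) (\<lambda>(T, j). monom 1 (mult_semigroup.s S m j)) ?I (\<lambda>d p q. specialize S (?N d p q)) \<and>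
       (\<forall>e. \<forall>i\<in>?I e. \<forall>k\<in>?I (Suc e). homogeneous S (mult_semigroup.shift S m k - mult_semigroup.shift S m i) (specialize S (?N e i k)))"
    if S: "S \<in> G" for S
  proof -
    interpret mult_semigroup S m by (rule G[OF S])
    let ?D = "\<lambda>d p q. specialize S (N d p q)"
    have res: "inR.resolution m (toric S) (\<lambda>(T, j). monom 1 (s j)) I ?D"
      and hom: "\<And>e i k. i \<in> I e \<Longrightarrow> k \<in> I (Suc e) \<Longrightarrow> homogeneous S (shift k - shift i) (?D e i k)"
      using ur S by (auto simp: uniform_resolution_def)
    have cS: "cterm (?D d p q) = c" using c(2)[OF S] .
    have pivot: "?D d p q = Poly_Mapping.single 0 c" "shift q - shift p = 0"
      using homogeneous_eq_const[OF hom[OF pq(1,2)]] cS c(1) by auto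
    then have unit: "?D d p q * ?c = 1"
      using c(1) by (simp add: mult_single)
    have "(\<lambda>e i k. specialize S (?N e i k)) = ?D(d := schur (?D d) ?c p q)"
      by (auto simp: fun_eq_iff specialize_schur)
    moreover have "inR.resolution m (toric S) (\<lambda>(T, j). monom 1 (s j)) ?I (?D(d := schur (?D d) ?c p q))"
      by (rule inR.resolution_cancel[OF res _ _ pq(1,2) unit])
         (auto simp: toric_simps inR_iff_vars_in)
    moreover have "homogeneous S (shift k - shift i) (specialize S (?N e i k))" if "i \<in> ?I e" "k \<in> ?I (Suc e)" for e i k
    proof -
      have ik: "i \<in> I e" "k \<in> I (Suc e)" using that sub by blast+
      show ?thesis
      proof (cases "e = d")
        case True
        \<comment> \<open>A unit entry joins basis elements of equal degree, so the correction term
          of the Schur complement has the degree of the entry it changes.\<close>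
        have "shift k - shift i = 0 + (shift q - shift i) + (shift k - shift p)"
          using pivot(2) by simp
        then have "homogeneous S (shift k - shift i) (?c * ?D d i q * ?D d p k)"
          using hom[of i d q] hom[of p d k] ik pq True
          by (metis homogeneous_mult homogeneous_const)
        then show ?thesis
          using hom[OF ik] True by (simp add: specialize_schur) (simp add: schur_def homogeneous_diff)
      qed (use hom[OF ik] in simp)
    qed
    ultimately show ?thesis by simp
  qed
  moreover have "({}, 0) \<in> ?I 0"
    using ur pq(3) by (auto simp: uniform_resolution_def)
  moreover have "?I e \<subseteq> kos_index m e" for e
    using sub[of e] ur unfolding uniform_resolution_def by blast
  ultimately show ?thesis
    unfolding uniform_resolution_def by blast
qed

text \<open>Each cancellation lowers the number of basis elements. A pivot found for one
  \<open>S\<close> serves all of \<open>G\<close>, since its constant term is the same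
  throughout.\<close>

lemma uniform_resolution_reduce:
  fixes N :: "nat \<Rightarrow> nat set \<times> nat \<Rightarrow> nat set \<times> nat \<Rightarrow> (sym, 'k::field) mpoly"
  assumes G: "\<And>S. S \<in> G \<Longrightarrow> mult_semigroup S m" and m: "m > 0" and S0: "S0 \<in> G"
    and cong: "\<And>f S S'. formal_ok m f \<Longrightarrow> S \<in> G \<Longrightarrow> S' \<in> G \<Longrightarrow>
      cterm (specialize S f :: (nat, 'k) mpoly) = cterm (specialize S' f)"
    and ur: "uniform_resolution m G I N"
  shows "\<exists>I' (N' :: nat \<Rightarrow> nat set \<times> nat \<Rightarrow> nat set \<times> nat \<Rightarrow> (sym, 'k) mpoly). uniform_resolution m G I' N' \<and>
    (\<forall>d. \<forall>p\<in>I' d. \<forall>q\<in>I' (Suc d). \<not> (d = 0 \<and> p = ({}, 0)) \<longrightarrow> (\<forall>S\<in>G. cterm (specialize S (N' d p q)) = 0))"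
  using ur
proof (induction "card (SIGMA d:{..<m}. I d)" arbitrary: I N rule: less_induct)
  case less
  show ?case
  proof (cases "\<forall>d. \<forall>p\<in>I d. \<forall>q\<in>I (Suc d). \<not> (d = 0 \<and> p = ({}, 0)) \<longrightarrow> (\<forall>S\<in>G. cterm (specialize S (N d p q)) = 0)")
    case True
    then show ?thesis using less.prems by blast
  next
    case False
    then obtain d p q S where pq: "p \<in> I d" "q \<in> I (Suc d)" "\<not> (d = 0 \<and> p = ({}, 0))"
      and S: "S \<in> G" "cterm (specialize S (N d p q)) \<noteq> 0" by blast
    let ?c = "cterm (specialize S (N d p q))"
    let ?I = "I(d := I d - {p}, Suc d := I (Suc d) - {q})"
    have "formal_ok m (N d p q)" using less.prems pq by (simp add: uniform_resolution_def)
    then have "cterm (specialize S' (N d p q)) = ?c" if "S' \<in> G" for S'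
      using cong S that by blast
    then have ur': "uniform_resolution m G ?I (N(d := schur (N d) (Poly_Mapping.single 0 (1 / ?c)) p q))"
      by (intro uniform_resolution_cancel[OF G less.prems pq S(2)])
    have kos: "I e \<subseteq> kos_index m e" for e using less.prems by (simp add: uniform_resolution_def)
    have fin: "finite (I e)" for e using finite_subset[OF kos finite_kos_index] .
    \<comment> \<open>The complex vanishes from degree \<open>m\<close> on, so the removed
      \<open>p\<close> is seen by the finite count over degrees below \<open>m\<close>.\<close>
    have "d < m" using kos[of d] pq(1) kos_index_empty[of m d] m by (cases "d < m") auto
    then have "(d, p) \<in> (SIGMA d:{..<m}. I d)" "(d, p) \<notin> (SIGMA d:{..<m}. ?I d)" using pq by auto
    moreover have "(SIGMA d:{..<m}. ?I d) \<subseteq> (SIGMA d:{..<m}. I d)" by (auto split: if_splits)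
    ultimately have "(SIGMA d:{..<m}. ?I d) \<subset> (SIGMA d:{..<m}. I d)"
      by blast
    then have "card (SIGMA d:{..<m}. ?I d) < card (SIGMA d:{..<m}. I d)"
      using fin by (intro psubset_card_mono finite_SigmaI) auto
    then show ?thesis using ur' by (rule less.hyps)
  qed
qed

section \<open>Passage to numbered bases\<close>

lemma freemod_exact:
  assumes ex: "exact_at (Collect (inR m)) K J D L"
    and D: "\<And>j l. j \<in> J \<Longrightarrow> l \<in> L \<Longrightarrow> inR m (D j l :: (nat, 'k::field) mpoly)"
    and hJ: "bij_betw hJ {..<r} J" and hL: "bij_betw hL {..<t} L"
  shows "matmap r t (\<lambda>i k. D (hJ i) (hL k)) ` freemod m t
    = {v \<in> freemod m r. K (\<lambda>x. v (the_inv_into {..<r} hJ x))}"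
proof -
  have invJ: "the_inv_into {..<r} hJ (hJ i) = i" if "i < r" for i
    using hJ that by (auto simp: bij_betw_def intro: the_inv_into_f_f)
  have invL: "the_inv_into {..<t} hL (hL i) = i" if "i < t" for i
    using hL that by (auto simp: bij_betw_def intro: the_inv_into_f_f)
  have J: "J = hJ ` {..<r}" and L: "L = hL ` {..<t}" using hJ hL by (auto simp: bij_betw_def)
  have sumL: "(\<Sum>l\<in>L. g l) = (\<Sum>k<t. g (hL k))" for g :: "_ \<Rightarrow> (nat, 'k) mpoly"
    using sum.reindex_bij_betw[OF hL, of g] by simp
  have K: "K (\<lambda>x. v (the_inv_into {..<r} hJ x)) \<longleftrightarrow>
     (\<exists>w. (\<forall>l\<in>L. inR m (w l)) \<and> (\<forall>i<r. v i = (\<Sum>k<t. D (hJ i) (hL k) * w (hL k))))"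
    if "v \<in> freemod m r" for v
  proof -
    have "\<forall>j\<in>J. v (the_inv_into {..<r} hJ j) \<in> Collect (inR m)"
      using that by (auto simp: J invJ freemod_def)
    from ex[unfolded exact_at_def, THEN spec, THEN mp, OF this] show ?thesis
      by (simp add: J invJ sumL) (simp add: Ball_def)
  qed
  show ?thesis
  proof (intro set_eqI iffI)
    fix v assume "v \<in> matmap r t (\<lambda>i k. D (hJ i) (hL k)) ` freemod m t"
    then obtain w where w: "w \<in> freemod m t" "v = matmap r t (\<lambda>i k. D (hJ i) (hL k)) w" by blast
    have "inR m (\<Sum>k<t. D (hJ i) (hL k) * w k)" if "i < r" for i
      using w(1) D that unfolding inR_iff_vars_in
      by (intro vars_in_sum vars_in_mult) (auto simp: J L freemod_def inR_iff_vars_in)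
    then have v: "v \<in> freemod m r"
      by (simp add: w(2) freemod_def matmap_def)
    have "\<exists>w. (\<forall>l\<in>L. inR m (w l)) \<and> (\<forall>i<r. v i = (\<Sum>k<t. D (hJ i) (hL k) * w (hL k)))"
      using w by (intro exI[of _ "\<lambda>x. w (the_inv_into {..<t} hL x)"]) (auto simp: L invL freemod_def matmap_def)
    then show "v \<in> {v \<in> freemod m r. K (\<lambda>x. v (the_inv_into {..<r} hJ x))}"
      using v K by blast
  next
    fix v assume v: "v \<in> {v \<in> freemod m r. K (\<lambda>x. v (the_inv_into {..<r} hJ x))}"
    then obtain w where w: "\<forall>l\<in>L. inR m (w l)" "\<forall>i<r. v i = (\<Sum>k<t. D (hJ i) (hL k) * w (hL k))"
      using K by blast
    \<comment> \<open>\<open>freemod\<close> demands zeros beyond the rank, which the coefficients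
      \<open>w\<close> do not provide.\<close>
    let ?w = "\<lambda>k. if k < t then w (hL k) else 0"
    have "?w \<in> freemod m t" using w(1) by (auto simp: freemod_def L)
    moreover have "v = matmap r t (\<lambda>i k. D (hJ i) (hL k)) ?w"
      using v w(2) by (auto simp: fun_eq_iff matmap_def freemod_def)
    ultimately show "v \<in> matmap r t (\<lambda>i k. D (hJ i) (hL k)) ` freemod m t" by blast
  qed
qed

lemma in_ker_matmap:
  assumes hI: "bij_betw hI {..<q} I" and hJ: "bij_betw hJ {..<r} J"
  shows "in_ker I C J (\<lambda>x. v (the_inv_into {..<r} hJ x)) \<longleftrightarrow> matmap q r (\<lambda>i j. C (hI i) (hJ j)) v = (\<lambda>_. 0)"
proof -
  have invJ: "the_inv_into {..<r} hJ (hJ i) = i" if "i < r" for i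
    using hJ that by (auto simp: bij_betw_def intro: the_inv_into_f_f)
  have I: "I = hI ` {..<q}" using hI by (auto simp: bij_betw_def)
  have "(\<Sum>j\<in>J. C i j * v (the_inv_into {..<r} hJ j)) = (\<Sum>j<r. C i (hJ j) * v j)" for i
    using sum.reindex_bij_betw[OF hJ, of "\<lambda>j. C i j * v (the_inv_into {..<r} hJ j)"] invJ by simp
  then show ?thesis
    by (auto simp: in_ker_def I matmap_def fun_eq_iff)
qed

lemma graded_min_free_res_reindex:
  fixes N :: "nat \<Rightarrow> nat set \<times> nat \<Rightarrow> nat set \<times> nat \<Rightarrow> (sym, 'k::field) mpoly"
  assumes G: "\<And>S. S \<in> G \<Longrightarrow> mult_semigroup S m" and ur: "uniform_resolution m G I N"
    and min: "\<And>d p q S. p \<in> I d \<Longrightarrow> q \<in> I (Suc d) \<Longrightarrow> \<not> (d = 0 \<and> p = ({}, 0)) \<Longrightarrow> S \<in> G \<Longrightarrow>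
      cterm (specialize S (N d p q)) = 0"
    and h: "\<And>d. bij_betw (h d) {..<card (I d)} (I d)" and S: "S \<in> G"
  shows "graded_min_free_res S (\<lambda>d. card (I d)) (\<lambda>d i k. specialize S (N (d - 1) (h (d - 1) i) (h d k)))"
proof -
  interpret mult_semigroup S m by (rule G[OF S])
  let ?D = "\<lambda>d p q. specialize S (N d p q)"
  let ?a = "\<lambda>(T, j). monom 1 (s j) :: 'k poly"
  have res: "inR.resolution m (toric S) ?a I ?D"
    and hom: "\<And>e i k. i \<in> I e \<Longrightarrow> k \<in> I (Suc e) \<Longrightarrow> homogeneous S (shift k - shift i) (?D e i k)"
    using ur S by (auto simp: uniform_resolution_def)
  have a0: "({}, 0) \<in> I 0" and kos: "\<And>d. I d \<subseteq> kos_index m d"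
    using ur by (auto simp: uniform_resolution_def)
  have fin: "\<And>d. finite (I d)" and DR: "\<And>d p q. p \<in> I d \<Longrightarrow> q \<in> I (Suc d) \<Longrightarrow> inR m (?D d p q)"
    and ex0: "exact_at (Collect (inR m)) (\<lambda>u. (\<Sum>k\<in>I 0. ?a k * toric S (u k)) = 0) (I 0) (?D 0) (I 1)"
    and ex: "\<And>d. exact_at (Collect (inR m)) (in_ker (I d) (?D d) (I (Suc d))) (I (Suc d)) (?D (Suc d)) (I (Suc (Suc d)))"
    using res unfolding inR.resolution_def by auto
  \<comment> \<open>A further generator $k = (\emptyset, j)$ is redundant: $e_k - x_j e_0$ is a relation with unit coefficient.\<close>
  have I0: "I 0 = {({}, 0)}"
  proof (rule ccontr)
    assume "I 0 \<noteq> {({}, 0)}"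
    then obtain k where k: "k \<in> I 0" "k \<noteq> ({}, 0)" using a0 by blast
    then obtain j where j: "k = ({}, j)" "j < m" "j \<noteq> 0"
      using kos[of 0] finite_subset[of "fst k" "{1..m - 1}"] by (cases k) (auto simp: kos_index_def)
    define u where "u x = (if x = k then 1 else if x = ({}, 0) then - Var j else 0 :: (nat, 'k) mpoly)" for x
    have "(\<Sum>x\<in>I 0. ?a x * toric S (u x)) = (\<Sum>x\<in>{k, ({}, 0)}. ?a x * toric S (u x))"
      using k a0 fin by (intro sum.mono_neutral_right) (auto simp: u_def toric_simps)
    also have "\<dots> = 0"
      using j by (simp add: u_def toric_simps s_0 apery_eq)
    finally have "(\<Sum>x\<in>I 0. ?a x * toric S (u x)) = 0" .
    moreover have "\<forall>x\<in>I 0. u x \<in> Collect (inR m)"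
      using j by (auto simp: u_def inR_iff_vars_in intro!: vars_in_uminus vars_in_Var)
    ultimately obtain w where "\<forall>x\<in>I 0. u x = (\<Sum>l\<in>I 1. ?D 0 x l * w l)"
      using ex0 unfolding exact_at_def by blast
    then have "u k = (\<Sum>l\<in>I 1. ?D 0 k l * w l)" using k by blast
    then have "cterm (u k) = (\<Sum>l\<in>I 1. cterm (?D 0 k l) * cterm (w l))"
      by (simp add: cterm_sum cterm_mult)
    also have "\<dots> = 0" using min[OF k(1) _ _ S] k by (intro sum.neutral) auto
    finally show False by (simp add: u_def)
  qed
  have cterm0: "cterm (?D d p q) = 0" if pq: "p \<in> I d" "q \<in> I (Suc d)" for d p q
  proof (cases "d = 0 \<and> p = ({}, 0)")
    case True
    \<comment> \<open>The row of \<open>({}, 0)\<close> is not covered by \<open>min\<close>. Its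
      entry in column \<open>q\<close> is the image of a unit vector, hence in the kernel of
      \<open>toric\<close>, and \<open>toric\<close> preserves constant terms.\<close>
    have "(\<Sum>k\<in>I 0. ?a k * toric S (\<Sum>l\<in>I 1. ?D 0 k l * (if l = q then 1 else 0))) = 0"
      using DR[of _ 0] by (intro inR.exact_at_image[OF ex0]) (auto simp: inR_iff_vars_in)
    then have "toric S (?D 0 ({}, 0) q) = 0"
      using pq True fin by (simp add: I0 s_0 if_distrib[where f = "(*) _"] cong: if_cong)
    then have "coeff (toric S (?D 0 ({}, 0) q)) 0 = 0" by simp
    then show ?thesis using True by (simp add: coeff_toric_0)
  qed (use min[OF pq _ S] in blast)
  have hmem: "h d i \<in> I d" if "i < card (I d)" for d i
    using h[of d] that by (auto simp: bij_betw_def)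
  have h00: "h 0 0 = ({}, 0)" using hmem[of 0 0] by (simp add: I0)
  have inv0: "the_inv_into {..<card (I 0)} (h 0) ({}, 0) = 0"
    using the_inv_into_f_f[of "h 0" "{..<card (I 0)}" 0] h[of 0] h00 by (auto simp: I0 bij_betw_def)
  have image0: "matmap 1 (card (I 1)) (\<lambda>i k. ?D 0 (h 0 i) (h 1 k)) ` freemod m (card (I 1))
      = {v. \<exists>f\<in>apery_ideal S. v = (\<lambda>i. if i = 0 then f else 0)}"
  proof -
    have "matmap 1 (card (I 1)) (\<lambda>i k. ?D 0 (h 0 i) (h 1 k)) ` freemod m (card (I 1))
      = {v \<in> freemod m 1. (\<Sum>k\<in>I 0. ?a k * toric S (v (the_inv_into {..<card (I 0)} (h 0) k))) = 0}"
      using freemod_exact[OF ex0 _ h[of 0] h[of 1]] DR[of _ 0] by (simp add: I0)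
    also have "\<dots> = {v \<in> freemod m 1. toric S (v 0) = 0}"
      using inv0 by (simp add: I0 s_0)
    also have "\<dots> = {v. \<exists>f\<in>apery_ideal S. v = (\<lambda>i. if i = 0 then f else 0)}"
      by (auto simp: apery_ideal_iff mult freemod_def fun_eq_iff)
    finally show ?thesis .
  qed
  have exact: "{u \<in> freemod m (card (I (Suc d))). matmap (card (I d)) (card (I (Suc d))) (\<lambda>i k. ?D d (h d i) (h (Suc d) k)) u = (\<lambda>_. 0)}
      = matmap (card (I (Suc d))) (card (I (Suc (Suc d)))) (\<lambda>i k. ?D (Suc d) (h (Suc d) i) (h (Suc (Suc d)) k)) ` freemod m (card (I (Suc (Suc d))))" for d
    using freemod_exact[OF ex[of d] DR h h] by (simp add: in_ker_matmap[OF h h])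
  show ?thesis
    unfolding graded_min_free_res_def Let_def mult
  proof (intro conjI allI impI)
    show "card (I 0) = 1" by (simp add: I0)
    show "matmap 1 (card (I 1)) (\<lambda>i k. specialize S (N (1 - 1) (h (1 - 1) i) (h 1 k))) ` freemod m (card (I 1))
      = {v. \<exists>f\<in>apery_ideal S. v = (\<lambda>i. if i = 0 then f else 0)}"
      using image0 by simp
  next
    fix d :: nat assume "1 \<le> d"
    then obtain e where d: "d = Suc e" by (cases d) auto
    show "{u \<in> freemod m (card (I d)). matmap (card (I (d - 1))) (card (I d)) (\<lambda>i k. specialize S (N (d - 1) (h (d - 1) i) (h d k))) u = (\<lambda>_. 0)}
      = matmap (card (I d)) (card (I (d + 1))) (\<lambda>i k. specialize S (N (d + 1 - 1) (h (d + 1 - 1) i) (h (d + 1) k))) ` freemod m (card (I (d + 1)))"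
      using exact[of e] by (simp add: d)
    fix i k assume "i < card (I (d - 1))" "k < card (I d)"
    then have ik: "h (d - 1) i \<in> I (d - 1)" "h d k \<in> I (Suc (d - 1))" using hmem d by auto
    show "inR m (specialize S (N (d - 1) (h (d - 1) i) (h d k)))" by (rule DR[OF ik])
    show "Poly_Mapping.lookup (specialize S (N (d - 1) (h (d - 1) i) (h d k))) 0 = 0"
      using cterm0[OF ik] by (simp add: cterm_def)
  next
    have "shift (h 0 0) = 0" by (simp add: h00 shift_def s_0)
    moreover have "homogeneous S (shift (h d k) - shift (h (d - 1) i)) (specialize S (N (d - 1) (h (d - 1) i) (h d k)))"
      if "d \<ge> 1" "i < card (I (d - 1))" "k < card (I d)" for d i k
      using that hmem by (intro hom) auto
    ultimately show "\<exists>sh. sh 0 0 = 0 \<and> (\<forall>d\<ge>1. \<forall>i<card (I (d - 1)). \<forall>k<card (I d).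
        homogeneous S (sh d k - sh (d - 1) i) (specialize S (N (d - 1) (h (d - 1) i) (h d k))))"
      by (intro exI[of _ "\<lambda>d k. shift (h d k)"]) blast
  qed
qed

theorem theorem4p4:
  fixes m :: nat and e :: "nat \<Rightarrow> 'n::finite" and F :: "(real^'n) set"
  assumes "m \<ge> 2"
    and "bij_betw e {1..<m} (UNIV :: 'n set)"
    and "F face_of kunz_cone m e"
  shows "\<exists>(r :: nat \<Rightarrow> nat) (N :: nat \<Rightarrow> nat \<Rightarrow> nat \<Rightarrow> (sym, 'k::field) mpoly).
           (\<forall>d\<ge>1. \<forall>i<r (d - 1). \<forall>k<r d. formal_ok m (N d i k)) \<and>
           (\<forall>S. numerical_semigroup S \<and> multiplicity S = m \<and> apery_vec m e S \<in> rel_interior F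
                \<longrightarrow> graded_min_free_res S r (\<lambda>d i k. specialize S (N d i k)))"
proof -
  define G where "G = {S. numerical_semigroup S \<and> multiplicity S = m \<and> apery_vec m e S \<in> rel_interior F}"
  have G: "mult_semigroup S m" if "S \<in> G" for S
    using that by (simp add: G_def mult_semigroup_def)
  show ?thesis
  proof (cases "G = {}")
    case True
    \<comment> \<open>With no semigroup to resolve, ranks equal to zero leave no entries to
      check.\<close>
    then show ?thesis
      by (intro exI[of _ "\<lambda>_. 0"]) (auto simp: G_def)
  next
    case False
    then obtain S0 where S0: "S0 \<in> G" by blast
    have inj: "inj_on e {1..<m}" using assms(2) by (simp add: bij_betw_def)
    have F: "convex F" "F \<subseteq> kunz_cone m e" using assms(3) by (auto simp: face_of_def)
    \<comment> \<open>\<open>x_i\<close> never has a constant term, and \<open>y^{b_{i,j}}\<close>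
      has constant term 1 exactly if \<open>b_{i,j} = 0\<close>, which is decided by
      \<open>F\<close> alone.\<close>
    have val: "cterm (sym_val S v :: (nat, 'k) mpoly) = cterm (sym_val S' v :: (nat, 'k) mpoly)"
      if "sym_ok m v" "S \<in> G" "S' \<in> G" for v S S'
    proof (cases v)
      case (X i)
      then show ?thesis by (simp add: sym_val_def)
    next
      case (Y i j)
      then have ij: "1 \<le> i" "i < m" "1 \<le> j" "j < m"
        using that(1) by (auto simp: sym_ok_def)
      have "apery_vec m e S \<in> rel_interior F" "apery_vec m e S' \<in> rel_interior F"
        using that by (auto simp: G_def)
      then have "b_coef S i j = 0 \<longleftrightarrow> b_coef S' i j = 0"
        using b_coef_zero_pattern[OF inj F _ _ _ _ ij] G[OF that(2)] G[OF that(3)] by blast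
      then show ?thesis using Y by (simp add: sym_val_def cterm_power power_0_left)
    qed
    have m: "m > 0" using assms(1) by simp
    have cong: "cterm (specialize S f :: (nat, 'k) mpoly) = cterm (specialize S' f)"
      if "formal_ok m f" "S \<in> G" "S' \<in> G" for f S S'
      using cterm_specialize_cong[OF that(1) val[OF _ that(2,3)]] .
    have "\<exists>I (N :: nat \<Rightarrow> nat set \<times> nat \<Rightarrow> nat set \<times> nat \<Rightarrow> (sym, 'k) mpoly). uniform_resolution m G I N \<and>
      (\<forall>d. \<forall>p\<in>I d. \<forall>q\<in>I (Suc d). \<not> (d = 0 \<and> p = ({}, 0)) \<longrightarrow> (\<forall>S\<in>G. cterm (specialize S (N d p q)) = 0))"
      by (rule uniform_resolution_reduce[OF G m S0 cong uniform_resolution_kos[OF G m]])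
    then obtain I and N :: "nat \<Rightarrow> nat set \<times> nat \<Rightarrow> nat set \<times> nat \<Rightarrow> (sym, 'k) mpoly"
      where ur: "uniform_resolution m G I N"
      and min: "\<forall>d. \<forall>p\<in>I d. \<forall>q\<in>I (Suc d). \<not> (d = 0 \<and> p = ({}, 0)) \<longrightarrow> (\<forall>S\<in>G. cterm (specialize S (N d p q)) = 0)"
      by (elim exE conjE) (rule that)
    have finI: "finite (I d)" for d
      by (rule finite_subset[OF _ finite_kos_index[of m d]]) (use ur in \<open>simp add: uniform_resolution_def\<close>)
    have "\<forall>d. \<exists>f. bij_betw f {..<card (I d)} (I d)"
      using ex_bij_betw_nat_finite[OF finI] by (simp add: atLeast0LessThan)
    from choice[OF this] obtain h where h: "\<And>d. bij_betw (h d) {..<card (I d)} (I d)" by blast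
    show ?thesis
    proof (intro exI conjI allI impI)
      fix d i k :: nat assume "1 \<le> d" "i < card (I (d - 1))" "k < card (I d)"
      then have "h (d - 1) i \<in> I (d - 1)" "h d k \<in> I (Suc (d - 1))"
        using h by (auto simp: bij_betw_def)
      then show "formal_ok m (N (d - 1) (h (d - 1) i) (h d k))"
        using ur \<open>1 \<le> d\<close> by (simp add: uniform_resolution_def)
    next
      fix S assume "numerical_semigroup S \<and> multiplicity S = m \<and> apery_vec m e S \<in> rel_interior F"
      then have S: "S \<in> G" by (simp add: G_def)
      have "cterm (specialize S (N d p q)) = 0"
        if "p \<in> I d" "q \<in> I (Suc d)" "\<not> (d = 0 \<and> p = ({}, 0))" "S \<in> G" for d p q S
        using min[THEN spec, THEN bspec[OF _ that(1)], THEN bspec[OF _ that(2)]] that(3,4) by blast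
      from graded_min_free_res_reindex[OF G ur this h S] show "graded_min_free_res S (\<lambda>d. card (I d)) (\<lambda>d i k. specialize S (N (d - 1) (h (d - 1) i) (h d k)))"
        by blast
    qed
  qed
qed

end
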